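(* Let $D,m\ge 1$ and let $0\neq w\in\mathrm{Sym}^D\mathbb{C}^m$ be a polystable form. Then the degree monoid $\mathcal{E}(w)\subseteq\mathbb{N}$ generates the subgroup $b(w)\mathbb{Z}$ of $\mathbb{Z}$, where $b(w)=\frac{m}{D}a(w)$ is the degree period of $w$.
   Context: Work over $\mathbb{C}$. $\mathrm{Sym}^D\mathbb{C}^m$ is the space of homogeneous polynomials (forms) of degree $D$ in $X_1,\dots,X_m$, identified with the symmetric tensors in $\bigotimes^D\mathbb{C}^m$, with the natural action of $G:=\mathrm{GL}_m$ ($g$ acts as $g^{\otimes D}$; in particular $t\,\mathrm{I}_m$ acts as multiplication by $t^D$). A form $w$ is polystable if its $\mathrm{SL}_m$-orbit is closed. $\mathrm{stab}(w)=\{g\in\mathrm{GL}_m\mid gw=w\}$. For nonzero polystable $w$ the group $\det(\mathrm{stab}(w))\subseteq\mathbb{C}^\times$ is finite; the stabilizer period $a(w)$ is its order, and the degree period is $b(w):=\frac{m}{D}a(w)$, which is a positive integer. $\overline{Gw}$ denotes the closure of the orbit $Gw$ (an affine variety stable under scalar multiplication), $\mathcal{O}(\overline{Gw})$ its coordinate ring, and $\mathcal{O}(\overline{Gw})^{\mathrm{SL}_m}_d$ the space of $\mathrm{SL}_m$-invariant functions in $\mathcal{O}(\overline{Gw})$ that are homogeneous of degree $d$. The degree monoid is $\mathcal{E}(w):=\{d\in\mathbb{N}\mid \mathcal{O}(\overline{Gw})^{\mathrm{SL}_m}_d\neq 0\}$ (with $0\in\mathbb{N}$). *)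

theory Defs
  imports
    "HOL-Analysis.Analysis"
    "HOL-Library.Poly_Mapping"
    "HOL-Computational_Algebra.Group_Closure"
begin

type_synonym 'x cpoly = "('x \<Rightarrow>\<^sub>0 nat) \<Rightarrow>\<^sub>0 complex"

definition Const :: "complex \<Rightarrow> 'x cpoly" where
  "Const c = Poly_Mapping.single 0 c"

definition Var :: "'x \<Rightarrow> 'x cpoly" where
  "Var i = Poly_Mapping.single (Poly_Mapping.single i 1) 1"

definition peval :: "('x \<Rightarrow> complex) \<Rightarrow> 'x cpoly \<Rightarrow> complex" where
  "peval a p = (\<Sum>\<mu>\<in>Poly_Mapping.keys p. Poly_Mapping.lookup p \<mu> *
     (\<Prod>i\<in>Poly_Mapping.keys \<mu>. a i ^ Poly_Mapping.lookup \<mu> i))"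

definition psubst :: "('x \<Rightarrow> 'y cpoly) \<Rightarrow> 'x cpoly \<Rightarrow> 'y cpoly" where
  "psubst f p = (\<Sum>\<mu>\<in>Poly_Mapping.keys p. Const (Poly_Mapping.lookup p \<mu>) *
     (\<Prod>i\<in>Poly_Mapping.keys \<mu>. f i ^ Poly_Mapping.lookup \<mu> i))"

text \<open>\<open>Sym\<^sup>D \<complex>\<^sup>m\<close>, where \<open>m = CARD('m)\<close>.\<close>

definition forms :: "nat \<Rightarrow> 'm::finite cpoly set" where
  "forms D = {w. \<forall>\<mu>\<in>Poly_Mapping.keys w. (\<Sum>i\<in>UNIV. Poly_Mapping.lookup \<mu> i) = D}"

text \<open>The variable \<open>X\<^sub>j\<close> stands for the standard basis vector \<open>e\<^sub>j\<close>, so that \<open>g\<^sup>\<otimes>\<^sup>D\<close> substitutes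
  \<open>g e\<^sub>j = \<Sum>\<^sub>i g\<^sub>i\<^sub>j e\<^sub>i\<close> for \<open>X\<^sub>j\<close>. This is a left action.\<close>

definition act :: "complex^'m^'m \<Rightarrow> 'm::finite cpoly \<Rightarrow> 'm cpoly" where
  "act g w = psubst (\<lambda>j. \<Sum>i\<in>UNIV. Const (g $ i $ j) * Var i) w"

definition GL :: "(complex^'m^'m::finite) set" where
  "GL = {g. invertible g}"

definition SL :: "(complex^'m^'m::finite) set" where
  "SL = {g. det g = 1}"

definition orbit :: "(complex^'m^'m) set \<Rightarrow> 'm::finite cpoly \<Rightarrow> 'm cpoly set" where
  "orbit H w = (\<lambda>g. act g w) ` H"

definition stab :: "'m::finite cpoly \<Rightarrow> (complex^'m^'m) set" where
  "stab w = {g \<in> GL. act g w = w}"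

text \<open>The coordinates of a form are its coefficients, so a polynomial function on a set of forms is
  given by a polynomial whose variables are indexed by the monomials. Variables belonging to
  monomials of degree other than \<open>D\<close> vanish on \<open>forms D\<close>.\<close>

definition polyfun :: "('m \<Rightarrow>\<^sub>0 nat) cpoly \<Rightarrow> 'm cpoly \<Rightarrow> complex" where
  "polyfun p v = peval (Poly_Mapping.lookup v) p"

text \<open>For the orbits considered here (indeed for all constructible sets) the Zariski closure in
  \<open>forms D\<close> is also the closure in the Euclidean topology.\<close>

definition zariski_closed :: "nat \<Rightarrow> 'm::finite cpoly set \<Rightarrow> bool" where
  "zariski_closed D S \<longleftrightarrow> (\<exists>P. S = {v \<in> forms D. \<forall>p\<in>P. polyfun p v = 0})"

definition polystable :: "nat \<Rightarrow> 'm::finite cpoly \<Rightarrow> bool" where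
  "polystable D w \<longleftrightarrow> zariski_closed D (orbit SL w)"

definition orbit_closure :: "nat \<Rightarrow> 'm::finite cpoly \<Rightarrow> 'm cpoly set" where
  "orbit_closure D w = zariski_closed D hull orbit GL w"

text \<open>A function on \<open>X\<close> is represented by its extension by zero outside \<open>X\<close>, so that equality in the
  coordinate ring is equality of HOL functions.\<close>

definition coord_ring :: "'m::finite cpoly set \<Rightarrow> ('m cpoly \<Rightarrow> complex) set" where
  "coord_ring X = {f. (\<exists>p. \<forall>v\<in>X. f v = polyfun p v) \<and> (\<forall>v. v \<notin> X \<longrightarrow> f v = 0)}"

definition SL_invariants :: "'m::finite cpoly set \<Rightarrow> nat \<Rightarrow> ('m cpoly \<Rightarrow> complex) set" where
  "SL_invariants X d = {f \<in> coord_ring X.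
     (\<forall>g\<in>SL. \<forall>v\<in>X. f (act g v) = f v) \<and>
     (\<forall>t. \<forall>v\<in>X. f (Const t * v) = t ^ d * f v)}"

definition degree_monoid :: "nat \<Rightarrow> 'm::finite cpoly \<Rightarrow> nat set" where
  "degree_monoid D w = {d. SL_invariants (orbit_closure D w) d \<noteq> {\<lambda>_. 0}}"

text \<open>For nonzero polystable \<open>w\<close> the set \<open>det ` stab w\<close> is finite, and then the degree period is
  a positive integer; as a quotient it is defined here as a rational number.\<close>

definition stabilizer_period :: "'m::finite cpoly \<Rightarrow> nat" where
  "stabilizer_period w = card (det ` stab w)"

definition degree_period :: "nat \<Rightarrow> 'm::finite cpoly \<Rightarrow> rat" where
  "degree_period D w = of_nat CARD('m) / of_nat D * of_nat (stabilizer_period w)"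

end

theory Submission
  imports Defs "HOL-Computational_Algebra.Fundamental_Theorem_Algebra"
begin

text \<open>Let \<open>Y\<close> be the orbit of \<open>w\<close> under \<open>SL\<close>, let \<open>S\<close> be the degree monoid, and put
\<open>A = {c. c w \<in> Y}\<close>. The idea is to describe \<open>A\<close> twice: by the degrees of the invariants and by the
determinants of the stabilizer.

Every invertible matrix is a scalar matrix times an element of \<open>SL\<close>, and the scalar matrix \<open>t\<close>
acts on forms as \<open>t\<^sup>D\<close>. An invariant of degree \<open>d\<close> is therefore determined by its value at \<open>w\<close>, and
if it is not zero, then it takes the same nonzero value at \<open>w\<close> and at \<open>c w\<close> for \<open>c \<in> A\<close>. Thus
\<open>c\<^sup>d = 1\<close> for all \<open>c \<in> A\<close> and \<open>d \<in> S\<close> (\<open>power_degree_eq_1\<close>).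

The converse is the heart of the matter (\<open>ex_degree_power_neq_1\<close>). If \<open>c \<notin> A\<close>, then \<open>Y\<close> and \<open>c Y\<close>
are disjoint closed sets, and by the Nullstellensatz some polynomial \<open>r\<close> is \<open>1\<close> on \<open>Y\<close> and \<open>0\<close> on
\<open>c Y\<close>. Averaging the homogeneous components of \<open>r\<close> over \<open>SL\<close> gives invariants \<open>J\<^sub>d\<close> of degree \<open>d\<close>
with \<open>\<Sum>\<^sub>d J\<^sub>d(w) = 1\<close> and \<open>\<Sum>\<^sub>d c\<^sup>d J\<^sub>d(w) = 0\<close>. Hence \<open>c\<^sup>d \<noteq> 1\<close> for some \<open>d\<close> with \<open>J\<^sub>d(w) \<noteq> 0\<close>, and this
\<open>d\<close> lies in \<open>S\<close>. So \<open>A\<close> is the group of \<open>g\<close>-th roots of unity, where \<open>g\<close> is the gcd of \<open>S\<close>; the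
case \<open>c = 0\<close> shows \<open>g > 0\<close>.

On the other hand, \<open>t\<^sup>D \<in> A\<close> if and only if \<open>t\<^sup>m\<close> is the determinant of an element of the stabilizer.
Hence these determinants are the roots of unity of order \<open>D g / m\<close>, so the stabilizer period is
\<open>D g / m\<close> and the degree period is \<open>g\<close>, the generator of the group generated by \<open>S\<close>.

The averaging is Cayley's Omega process. A form \<open>P\<close> of degree \<open>m E\<close> in the entries of an
\<open>m \<times> m\<close> matrix is sent to the number \<open>det(\<partial>/\<partial>g)\<^sup>E P\<close>. This functional turns right translation by
\<open>h\<close> into multiplication by \<open>(det h)\<^sup>E\<close> (\<open>omega_translate\<close>), and it does not vanish on \<open>det\<^sup>E\<close>
because there it is a sum of squares (\<open>omega_det_power_nonzero\<close>). For homogeneous \<open>f\<close> the function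
\<open>v \<mapsto> det(\<partial>/\<partial>g)\<^sup>E (f(g v) (det g)\<^sup>k)\<close>, with \<open>k\<close> making the degree right, is then an \<open>SL\<close>-invariant,
and nothing is lost on functions that are constant along the orbit (\<open>SL_average_exists\<close>).\<close>

section \<open>Evaluation and substitution\<close>

definition mono_val :: "('x \<Rightarrow> 'r::comm_ring_1) \<Rightarrow> ('x \<Rightarrow>\<^sub>0 nat) \<Rightarrow> 'r" where
  "mono_val f \<mu> = (\<Prod>i\<in>Poly_Mapping.keys \<mu>. f i ^ Poly_Mapping.lookup \<mu> i)"

text \<open>Evaluation in a ring into which the coefficients are mapped by \<open>\<phi>\<close>. Both \<open>peval\<close> (with values
in \<open>\<complex>\<close>) and \<open>psubst\<close> (with values in polynomials) are of this kind, so the homomorphism laws need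
to be proved only once.\<close>

definition poly_val :: "(complex \<Rightarrow> 'r) \<Rightarrow> ('x \<Rightarrow> 'r::comm_ring_1) \<Rightarrow> 'x cpoly \<Rightarrow> 'r" where
  "poly_val \<phi> f p = (\<Sum>\<mu>\<in>Poly_Mapping.keys p. \<phi> (Poly_Mapping.lookup p \<mu>) * mono_val f \<mu>)"

definition scalar_hom :: "(complex \<Rightarrow> 'r::comm_ring_1) \<Rightarrow> bool" where
  "scalar_hom \<phi> \<longleftrightarrow> \<phi> 0 = 0 \<and> \<phi> 1 = 1 \<and> (\<forall>a b. \<phi> (a + b) = \<phi> a + \<phi> b) \<and> (\<forall>a b. \<phi> (a * b) = \<phi> a * \<phi> b)"

lemma mono_val_superset:
  assumes "finite A" "Poly_Mapping.keys \<mu> \<subseteq> A"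
  shows "mono_val f \<mu> = (\<Prod>i\<in>A. f i ^ Poly_Mapping.lookup \<mu> i)"
  unfolding mono_val_def using assms
  by (intro prod.mono_neutral_left) (auto simp: in_keys_iff)

lemma mono_val_0 [simp]: "mono_val f 0 = 1"
  by (simp add: mono_val_def)

lemma mono_val_single [simp]: "mono_val f (Poly_Mapping.single i n) = f i ^ n"
  by (cases "n = 0") (simp_all add: mono_val_def)

lemma mono_val_add: "mono_val f (\<mu> + \<nu>) = mono_val f \<mu> * mono_val f \<nu>"
proof -
  let ?A = "Poly_Mapping.keys \<mu> \<union> Poly_Mapping.keys \<nu>"
  have "mono_val f (\<mu> + \<nu>) = (\<Prod>i\<in>?A. f i ^ Poly_Mapping.lookup (\<mu> + \<nu>) i)"
    by (rule mono_val_superset) (auto simp: Poly_Mapping.keys_add)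
  also have "\<dots> = (\<Prod>i\<in>?A. f i ^ Poly_Mapping.lookup \<mu> i) * (\<Prod>i\<in>?A. f i ^ Poly_Mapping.lookup \<nu> i)"
    by (simp add: lookup_add power_add prod.distrib)
  also have "\<dots> = mono_val f \<mu> * mono_val f \<nu>"
    by (simp add: mono_val_superset[of ?A])
  finally show ?thesis .
qed

context
  fixes \<phi> :: "complex \<Rightarrow> 'r::comm_ring_1"
  assumes \<phi>: "scalar_hom \<phi>"
begin

lemma poly_val_superset:
  assumes "finite A" "Poly_Mapping.keys p \<subseteq> A"
  shows "poly_val \<phi> f p = (\<Sum>\<mu>\<in>A. \<phi> (Poly_Mapping.lookup p \<mu>) * mono_val f \<mu>)"
  unfolding poly_val_def using assms \<phi>
  by (intro sum.mono_neutral_left) (auto simp: in_keys_iff scalar_hom_def)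

lemma poly_val_0: "poly_val \<phi> f 0 = 0"
  by (simp add: poly_val_def)

lemma poly_val_single: "poly_val \<phi> f (Poly_Mapping.single \<mu> c) = \<phi> c * mono_val f \<mu>"
  using poly_val_superset[of "{\<mu>}" "Poly_Mapping.single \<mu> c" f] by simp

lemma poly_val_add: "poly_val \<phi> f (p + q) = poly_val \<phi> f p + poly_val \<phi> f q"
proof -
  let ?A = "Poly_Mapping.keys p \<union> Poly_Mapping.keys q"
  have "poly_val \<phi> f (p + q) = (\<Sum>\<mu>\<in>?A. \<phi> (Poly_Mapping.lookup (p + q) \<mu>) * mono_val f \<mu>)"
    by (rule poly_val_superset) (auto simp: Poly_Mapping.keys_add)
  also have "\<dots> = (\<Sum>\<mu>\<in>?A. \<phi> (Poly_Mapping.lookup p \<mu>) * mono_val f \<mu>)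
      + (\<Sum>\<mu>\<in>?A. \<phi> (Poly_Mapping.lookup q \<mu>) * mono_val f \<mu>)"
    using \<phi> by (simp add: lookup_add scalar_hom_def algebra_simps sum.distrib)
  also have "\<dots> = poly_val \<phi> f p + poly_val \<phi> f q"
    by (simp add: poly_val_superset[of ?A])
  finally show ?thesis .
qed

lemma poly_val_sum: "poly_val \<phi> f (\<Sum>k\<in>A. p k) = (\<Sum>k\<in>A. poly_val \<phi> f (p k))"
  by (induction A rule: infinite_finite_induct) (simp_all add: poly_val_0 poly_val_add)

end

lemma cpoly_eq_sum_single:
  "p = (\<Sum>\<mu>\<in>Poly_Mapping.keys p. Poly_Mapping.single \<mu> (Poly_Mapping.lookup p \<mu>))"
  by (rule poly_mapping_eqI) (simp add: lookup_sum lookup_single when_def in_keys_iff)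

lemma poly_val_mult:
  assumes \<phi>: "scalar_hom \<phi>"
  shows "poly_val \<phi> f (p * q) = poly_val \<phi> f p * poly_val \<phi> f q"
proof -
  have "poly_val \<phi> f (p * q) = poly_val \<phi> f
     ((\<Sum>\<mu>\<in>Poly_Mapping.keys p. Poly_Mapping.single \<mu> (Poly_Mapping.lookup p \<mu>)) *
      (\<Sum>\<mu>\<in>Poly_Mapping.keys q. Poly_Mapping.single \<mu> (Poly_Mapping.lookup q \<mu>)))"
    using cpoly_eq_sum_single by metis
  also have "\<dots> = (\<Sum>\<mu>\<in>Poly_Mapping.keys p. \<Sum>\<nu>\<in>Poly_Mapping.keys q.
      \<phi> (Poly_Mapping.lookup p \<mu>) * \<phi> (Poly_Mapping.lookup q \<nu>) * (mono_val f \<mu> * mono_val f \<nu>))"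
    using \<phi> by (simp add: sum_product poly_val_sum[OF \<phi>] mult_single poly_val_single[OF \<phi>]
        mono_val_add scalar_hom_def)
  also have "\<dots> = poly_val \<phi> f p * poly_val \<phi> f q"
    by (simp add: poly_val_def sum_product mult_ac)
  finally show ?thesis .
qed

lemma scalar_hom_id: "scalar_hom (\<lambda>c. c)"
  by (simp add: scalar_hom_def)

lemma scalar_hom_Const: "scalar_hom Const"
  by (simp add: scalar_hom_def Const_def single_add mult_single)

lemma Const_0 [simp]: "Const 0 = 0" and Const_1 [simp]: "Const 1 = 1"
  and Const_add: "Const (a + b) = Const a + Const b"
  and Const_mult: "Const (a * b) = Const a * Const b"
  by (simp_all add: Const_def single_add mult_single)

lemma Const_diff: "Const (a - b) = Const a - Const b"
  by (simp add: Const_def single_diff)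

lemma Const_power: "Const (a ^ n) = Const a ^ n"
  by (induction n) (simp_all add: Const_mult)

lemma Const_sum: "Const (\<Sum>k\<in>A. c k) = (\<Sum>k\<in>A. Const (c k))"
  by (induction A rule: infinite_finite_induct) (simp_all add: Const_add)

lemma lookup_Const_mult: "Poly_Mapping.lookup (Const c * p) \<mu> = c * Poly_Mapping.lookup p \<mu>"
proof -
  have "Poly_Mapping.lookup (Const c * p) \<mu> = Poly_Mapping.lookup (Poly_Mapping.map ((*) c) p) \<mu>"
    by (simp only: mult_map_scale_conv_mult Const_def)
  then show ?thesis by (simp add: Poly_Mapping.map.rep_eq when_def)
qed

lemma Const_mult_single: "Const c * Poly_Mapping.single \<mu> d = Poly_Mapping.single \<mu> (c * d)"
  by (simp add: Const_def mult_single)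

lemma peval_eq: "peval a p = poly_val (\<lambda>c. c) a p"
  by (simp add: peval_def poly_val_def mono_val_def)

lemma psubst_eq: "psubst f p = poly_val Const f p"
  by (simp add: psubst_def poly_val_def mono_val_def)

lemma peval_0 [simp]: "peval a 0 = 0"
  and peval_1 [simp]: "peval a 1 = 1"
  and peval_Const [simp]: "peval a (Const c) = c"
  and peval_Var [simp]: "peval a (Var i) = a i"
  and peval_add [simp]: "peval a (p + q) = peval a p + peval a q"
  and peval_mult [simp]: "peval a (p * q) = peval a p * peval a q"
  and peval_sum [simp]: "peval a (\<Sum>k\<in>A. r k) = (\<Sum>k\<in>A. peval a (r k))"
  using poly_val_single[OF scalar_hom_id, of a 0 1] poly_val_single[OF scalar_hom_id, of a 0 c]
    poly_val_single[OF scalar_hom_id, of a "Poly_Mapping.single i 1" 1]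
  by (simp_all add: peval_eq poly_val_0[OF scalar_hom_id] poly_val_add[OF scalar_hom_id]
      poly_val_mult[OF scalar_hom_id] poly_val_sum[OF scalar_hom_id] Const_def Var_def)

lemma peval_power [simp]: "peval a (p ^ n) = peval a p ^ n"
  by (induction n) simp_all

lemma peval_prod: "peval a (\<Prod>k\<in>A. r k) = (\<Prod>k\<in>A. peval a (r k))"
  by (induction A rule: infinite_finite_induct) simp_all

lemma psubst_0 [simp]: "psubst f 0 = 0"
  and psubst_1 [simp]: "psubst f 1 = 1"
  and psubst_Const [simp]: "psubst f (Const c) = Const c"
  and psubst_Var [simp]: "psubst f (Var i) = f i"
  and psubst_add [simp]: "psubst f (p + q) = psubst f p + psubst f q"
  and psubst_mult [simp]: "psubst f (p * q) = psubst f p * psubst f q"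
  and psubst_sum [simp]: "psubst f (\<Sum>k\<in>A. r k) = (\<Sum>k\<in>A. psubst f (r k))"
  using poly_val_single[OF scalar_hom_Const, of f 0 1] poly_val_single[OF scalar_hom_Const, of f 0 c]
    poly_val_single[OF scalar_hom_Const, of f "Poly_Mapping.single i 1" 1]
  by (simp_all add: psubst_eq poly_val_0[OF scalar_hom_Const] poly_val_add[OF scalar_hom_Const]
      poly_val_mult[OF scalar_hom_Const] poly_val_sum[OF scalar_hom_Const] Const_def Var_def)

lemma psubst_power [simp]: "psubst f (p ^ n) = psubst f p ^ n"
  by (induction n) simp_all

lemma psubst_prod: "psubst f (\<Prod>k\<in>A. r k) = (\<Prod>k\<in>A. psubst f (r k))"
  by (induction A rule: infinite_finite_induct) simp_all

lemma psubst_single: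
  "psubst f (Poly_Mapping.single \<mu> c) = Const c * mono_val f \<mu>"
  by (simp add: psubst_eq poly_val_single[OF scalar_hom_Const])

lemma psubst_psubst: "psubst f (psubst h p) = psubst (\<lambda>i. psubst f (h i)) p"
  by (simp add: psubst_def[of h] psubst_def[of "\<lambda>i. psubst f (h i)"] psubst_prod)

lemma peval_psubst: "peval a (psubst h p) = peval (\<lambda>i. peval a (h i)) p"
  by (simp add: psubst_def peval_def[of "\<lambda>i. peval a (h i)"] peval_prod)

lemma mono_val_Var: "mono_val Var \<mu> = Poly_Mapping.single \<mu> 1"
proof -
  have *: "Var i ^ n = Poly_Mapping.single (Poly_Mapping.single i n) 1" for i :: 'a and n
    by (induction n) (simp_all add: Var_def mult_single flip: single_add)
  have "(\<Prod>i\<in>A. Poly_Mapping.single (Poly_Mapping.single i (Poly_Mapping.lookup \<mu> i)) 1)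
      = (Poly_Mapping.single (\<Sum>i\<in>A. Poly_Mapping.single i (Poly_Mapping.lookup \<mu> i)) 1 :: 'a cpoly)" if "finite A" for A
    using that by (induction A) (simp_all add: mult_single)
  moreover have "(\<Sum>i\<in>Poly_Mapping.keys \<mu>. Poly_Mapping.single i (Poly_Mapping.lookup \<mu> i)) = \<mu>"
    by (rule poly_mapping_eqI) (simp add: lookup_sum lookup_single when_def in_keys_iff)
  ultimately show ?thesis by (simp add: mono_val_def *)
qed

lemma psubst_Var_id: "psubst Var p = p"
proof -
  have "psubst Var p = (\<Sum>\<mu>\<in>Poly_Mapping.keys p. Poly_Mapping.single \<mu> (Poly_Mapping.lookup p \<mu>))"
    by (simp add: psubst_eq poly_val_def mono_val_Var Const_mult_single)
  then show ?thesis using cpoly_eq_sum_single by metis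
qed

section \<open>The action of matrices on forms\<close>

lemma act_0 [simp]: "act g 0 = 0"
  and act_Const_mult: "act g (Const c * v) = Const c * act g v"
  and act_sum: "act g (\<Sum>k\<in>A. r k) = (\<Sum>k\<in>A. act g (r k))"
  by (simp_all add: act_def)

lemma act_act: "act g (act h v) = act (g ** h) v"
proof -
  have "psubst (\<lambda>j. \<Sum>i\<in>UNIV. Const (g $ i $ j) * Var i) (\<Sum>i\<in>UNIV. Const (h $ i $ j) * Var i)
     = (\<Sum>i\<in>UNIV. Const ((g ** h) $ i $ j) * Var i)" for j
  proof -
    have "psubst (\<lambda>j. \<Sum>i\<in>UNIV. Const (g $ i $ j) * Var i) (\<Sum>i\<in>UNIV. Const (h $ i $ j) * Var i)
      = (\<Sum>k\<in>UNIV. \<Sum>i\<in>UNIV. Const (g $ i $ k * h $ k $ j) * Var i)"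
      by (simp add: sum_distrib_left Const_mult mult_ac)
    also have "\<dots> = (\<Sum>i\<in>UNIV. \<Sum>k\<in>UNIV. Const (g $ i $ k * h $ k $ j) * Var i)"
      by (rule sum.swap)
    also have "\<dots> = (\<Sum>i\<in>UNIV. Const ((g ** h) $ i $ j) * Var i)"
      by (simp add: matrix_matrix_mult_def Const_sum sum_distrib_right)
    finally show ?thesis .
  qed
  then show ?thesis by (simp add: act_def psubst_psubst)
qed

lemma act_one [simp]: "act (mat 1) v = v"
proof -
  have "(\<Sum>i\<in>UNIV. Const ((mat 1 :: complex^'a^'a) $ i $ j) * Var i) = Var j" for j
    by (simp add: mat_def if_distrib[of Const] if_distrib[of "\<lambda>x. x * _"] cong: if_cong)
  then show ?thesis by (simp add: act_def psubst_Var_id)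
qed

definition monomials :: "nat \<Rightarrow> ('m::finite \<Rightarrow>\<^sub>0 nat) set" where
  "monomials D = {\<mu>. (\<Sum>i\<in>UNIV. Poly_Mapping.lookup \<mu> i) = D}"

lemma forms_iff: "v \<in> forms D \<longleftrightarrow> Poly_Mapping.keys v \<subseteq> monomials D"
  by (auto simp: forms_def monomials_def)

lemma finite_monomials [simp]: "finite (monomials D :: ('m::finite \<Rightarrow>\<^sub>0 nat) set)"
proof (rule finite_imageD)
  have "Poly_Mapping.lookup \<mu> i \<le> D" if "\<mu> \<in> monomials D" for \<mu> :: "'m \<Rightarrow>\<^sub>0 nat" and i
    using that member_le_sum[of i UNIV "Poly_Mapping.lookup \<mu>"] by (auto simp: monomials_def)
  then have "Poly_Mapping.lookup ` (monomials D :: ('m::finite \<Rightarrow>\<^sub>0 nat) set) \<subseteq> PiE UNIV (\<lambda>_. {..D})"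
    by auto
  then show "finite (Poly_Mapping.lookup ` (monomials D :: ('m::finite \<Rightarrow>\<^sub>0 nat) set))"
    by (rule finite_subset) (intro finite_PiE, auto)
  show "inj_on Poly_Mapping.lookup (monomials D :: ('m::finite \<Rightarrow>\<^sub>0 nat) set)"
    by (auto intro: inj_onI poly_mapping_eqI)
qed

lemma forms_0 [simp]: "0 \<in> forms D"
  and forms_add: "v \<in> forms D \<Longrightarrow> u \<in> forms D \<Longrightarrow> v + u \<in> forms D"
  using Poly_Mapping.keys_add[of v u] by (auto simp: forms_iff)

lemma forms_sum: "(\<And>k. k \<in> A \<Longrightarrow> r k \<in> forms D) \<Longrightarrow> (\<Sum>k\<in>A. r k) \<in> forms D"
  by (induction A rule: infinite_finite_induct) (auto intro: forms_add)

lemma forms_mult: "v \<in> forms D \<Longrightarrow> u \<in> forms E \<Longrightarrow> v * u \<in> forms (D + E)"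
  using keys_mult[of v u] by (fastforce simp: forms_iff monomials_def lookup_add sum.distrib)

lemma forms_Const_mult: "v \<in> forms D \<Longrightarrow> Const c * v \<in> forms D"
  by (auto simp: forms_iff in_keys_iff lookup_Const_mult subset_iff)

lemma forms_1 [simp]: "1 \<in> forms 0"
  by (simp add: forms_iff monomials_def)

lemma forms_Var [simp]: "Var i \<in> forms 1"
  by (simp add: forms_iff monomials_def Var_def lookup_single when_def)

lemma forms_power: "v \<in> forms D \<Longrightarrow> v ^ n \<in> forms (n * D)"
  by (induction n) (auto dest: forms_mult)

lemma forms_prod:
  "(\<And>k. k \<in> A \<Longrightarrow> r k \<in> forms (D k)) \<Longrightarrow> finite A \<Longrightarrow> (\<Prod>k\<in>A. r k) \<in> forms (\<Sum>k\<in>A. D k)"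
  by (induction A rule: infinite_finite_induct) (auto intro: forms_mult)

lemma sum_lookup_keys: "(\<Sum>i\<in>Poly_Mapping.keys \<mu>. Poly_Mapping.lookup \<mu> i) = (\<Sum>i\<in>UNIV. Poly_Mapping.lookup \<mu> i)"
  for \<mu> :: "'m::finite \<Rightarrow>\<^sub>0 nat"
  by (rule sum.mono_neutral_left) (auto simp: in_keys_iff)

lemma act_single:
  "act g (Poly_Mapping.single \<mu> c) = Const c * mono_val (\<lambda>j. \<Sum>i\<in>UNIV. Const (g $ i $ j) * Var i) \<mu>"
  by (simp add: act_def psubst_single)

lemma act_single_forms:
  assumes "\<mu> \<in> monomials D" shows "act g (Poly_Mapping.single \<mu> c) \<in> forms D"
proof -
  have "(\<Sum>i\<in>UNIV. Const (g $ i $ j) * Var i) \<in> forms 1" for j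
    by (intro forms_sum forms_Const_mult forms_Var)
  from forms_power[OF this]
  have "(\<Sum>i\<in>UNIV. Const (g $ i $ j) * Var i) ^ n \<in> forms n" for j n
    by simp
  then have "mono_val (\<lambda>j. \<Sum>i\<in>UNIV. Const (g $ i $ j) * Var i) \<mu> \<in> forms (\<Sum>i\<in>Poly_Mapping.keys \<mu>. Poly_Mapping.lookup \<mu> i)"
    unfolding mono_val_def by (intro forms_prod) auto
  then show ?thesis using assms
    by (simp add: act_single forms_Const_mult sum_lookup_keys monomials_def)
qed

lemma act_eq_sum:
  "act g v = (\<Sum>\<mu>\<in>Poly_Mapping.keys v. Const (Poly_Mapping.lookup v \<mu>) * act g (Poly_Mapping.single \<mu> 1))"
proof -
  have "act g v = act g (\<Sum>\<mu>\<in>Poly_Mapping.keys v. Const (Poly_Mapping.lookup v \<mu>) * Poly_Mapping.single \<mu> 1)"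
    using cpoly_eq_sum_single[of v] by (simp add: Const_mult_single)
  then show ?thesis by (simp add: act_sum act_Const_mult)
qed

lemma act_forms: "v \<in> forms D \<Longrightarrow> act g v \<in> forms D"
  unfolding act_eq_sum[of g v]
  by (auto simp: forms_iff[of v] intro!: forms_sum forms_Const_mult act_single_forms)

lemma act_mat:
  assumes "v \<in> forms D" shows "act (mat t) v = Const (t ^ D) * v"
proof -
  have *: "act (mat t) (Poly_Mapping.single \<mu> 1) = Const (t ^ D) * Poly_Mapping.single \<mu> 1" if "\<mu> \<in> monomials D" for \<mu> :: "'a \<Rightarrow>\<^sub>0 nat"
  proof -
    have "(\<Sum>i\<in>UNIV. Const ((mat t :: complex^'a^'a) $ i $ j) * Var i) = Const t * Var j" for j
      by (simp add: mat_def if_distrib[of Const] if_distrib[of "\<lambda>x. x * _"] cong: if_cong)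
    then have "act (mat t) (Poly_Mapping.single \<mu> 1) = mono_val (\<lambda>j. Const t * Var j) \<mu>"
      by (simp add: act_single)
    also have "\<dots> = (\<Prod>i\<in>Poly_Mapping.keys \<mu>. Const t ^ Poly_Mapping.lookup \<mu> i) * mono_val Var \<mu>"
      by (simp add: mono_val_def power_mult_distrib prod.distrib)
    also have "(\<Prod>i\<in>Poly_Mapping.keys \<mu>. Const t ^ Poly_Mapping.lookup \<mu> i) = (Const (t ^ D) :: 'a cpoly)"
      using that by (simp add: sum_lookup_keys monomials_def Const_power flip: power_sum)
    finally show ?thesis by (simp add: mono_val_Var)
  qed
  have "act (mat t) v = (\<Sum>\<mu>\<in>Poly_Mapping.keys v. Const (t ^ D) * (Const (Poly_Mapping.lookup v \<mu>) * Poly_Mapping.single \<mu> 1))"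
    unfolding act_eq_sum[of _ v] using assms by (intro sum.cong) (auto simp: forms_iff * mult_ac)
  also have "\<dots> = Const (t ^ D) * (\<Sum>\<mu>\<in>Poly_Mapping.keys v. Poly_Mapping.single \<mu> (Poly_Mapping.lookup v \<mu>))"
    unfolding sum_distrib_left by (simp only: Const_mult_single mult_1_right)
  also have "\<dots> = Const (t ^ D) * v"
    using cpoly_eq_sum_single[of v] by simp
  finally show ?thesis .
qed

section \<open>Homogeneous functions of a matrix\<close>

definition entry_mono :: "('m \<times> 'm) list \<Rightarrow> complex^'m^'m::finite \<Rightarrow> complex" where
  "entry_mono xs g = (\<Prod>(i, j)\<leftarrow>xs. g $ i $ j)"

text \<open>The forms of degree \<open>n\<close> in the matrix entries, as functions. The rules build them from monomials,
so that a statement that is linear in the form need only be checked on monomials.\<close>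

inductive entry_form :: "nat \<Rightarrow> (complex^'m^'m::finite \<Rightarrow> complex) \<Rightarrow> bool" for n where
  entry_form_0: "entry_form n (\<lambda>_. 0)"
| entry_form_step: "entry_form n P \<Longrightarrow> length xs = n \<Longrightarrow> entry_form n (\<lambda>g. P g + c * entry_mono xs g)"

lemma entry_form_mono: "length xs = n \<Longrightarrow> entry_form n (\<lambda>g. c * entry_mono xs g)"
  using entry_form_step[OF entry_form_0] by fastforce

lemma entry_form_const: "entry_form 0 (\<lambda>_. c)"
  using entry_form_mono[of "[]" 0 c] by (simp add: entry_mono_def)

lemma entry_form_entry: "entry_form 1 (\<lambda>g. g $ i $ j)"
  using entry_form_mono[of "[(i,j)]" 1 1] by (simp add: entry_mono_def)

lemma entry_form_add: "entry_form n Q \<Longrightarrow> entry_form n P \<Longrightarrow> entry_form n (\<lambda>g. P g + Q g)"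
  by (induction rule: entry_form.induct) (auto simp flip: add.assoc intro: entry_form_step)

lemma entry_form_sum: "(\<And>k. k \<in> A \<Longrightarrow> entry_form n (P k)) \<Longrightarrow> entry_form n (\<lambda>g. \<Sum>k\<in>A. P k g)"
  by (induction A rule: infinite_finite_induct) (auto intro: entry_form_0 entry_form_add)

lemma entry_form_mult_mono: "entry_form n P \<Longrightarrow> length ys = k \<Longrightarrow> entry_form (n + k) (\<lambda>g. P g * (c * entry_mono ys g))"
proof (induction rule: entry_form.induct)
  case (entry_form_step P xs d)
  have "(\<lambda>g. (P g + d * entry_mono xs g) * (c * entry_mono ys g)) =
     (\<lambda>g. P g * (c * entry_mono ys g) + (d * c) * entry_mono (xs @ ys) g)"
    by (simp add: fun_eq_iff entry_mono_def algebra_simps)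
  then show ?case using entry_form_step by (auto intro: entry_form.entry_form_step)
qed (auto intro: entry_form_0)

lemma entry_form_mult: "entry_form k Q \<Longrightarrow> entry_form n P \<Longrightarrow> entry_form (n + k) (\<lambda>g. P g * Q g)"
  by (induction rule: entry_form.induct) (auto simp: distrib_left intro: entry_form_0 entry_form_add entry_form_mult_mono)

lemma entry_form_cmult: "entry_form n P \<Longrightarrow> entry_form n (\<lambda>g. c * P g)"
  using entry_form_mult[OF _ entry_form_const, of n P c] by simp

lemma entry_form_power: "entry_form n P \<Longrightarrow> entry_form (k * n) (\<lambda>g. P g ^ k)"
  by (induction k) (auto intro: entry_form_const[of 1, simplified] entry_form_mult)

lemma entry_form_prod:
  "finite A \<Longrightarrow> (\<And>k. k \<in> A \<Longrightarrow> entry_form (n k) (P k)) \<Longrightarrow> entry_form (\<Sum>k\<in>A. n k) (\<lambda>g. \<Prod>k\<in>A. P k g)"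
proof (induction A rule: finite_induct)
  case empty then show ?case using entry_form_const[of 1] by simp
next
  case (insert a A)
  have "entry_form (n a + (\<Sum>k\<in>A. n k)) (\<lambda>g. P a g * (\<Prod>k\<in>A. P k g))"
    using insert by (intro entry_form_mult) auto
  then show ?case using insert by simp
qed

lemma entry_form_det: "entry_form CARD('m) (det :: complex^'m^'m::finite \<Rightarrow> complex)"
proof -
  have "entry_form (\<Sum>i\<in>(UNIV :: 'm set). 1) (\<lambda>g. \<Prod>i\<in>UNIV. g $ i $ p i)" for p :: "'m \<Rightarrow> 'm"
    by (intro entry_form_prod entry_form_entry) auto
  then have "entry_form CARD('m) (\<lambda>g. \<Sum>p\<in>{p. p permutes (UNIV :: 'm set)}. of_int (sign p) * (\<Prod>i\<in>UNIV. g $ i $ p i))"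
    by (intro entry_form_sum entry_form_cmult) simp
  then show ?thesis by (simp add: det_def[abs_def])
qed

lemma entry_form_continuous: "entry_form n P \<Longrightarrow> continuous_on UNIV P"
proof (induction rule: entry_form.induct)
  case (entry_form_step P xs c)
  have "continuous_on UNIV (\<lambda>g. entry_mono xs g)"
    by (induction xs) (auto simp: entry_mono_def intro!: continuous_intros)
  then show ?case using entry_form_step by (intro continuous_intros)
qed auto

section \<open>Polarization and the Omega process\<close>

text \<open>For a form \<open>P\<close> of degree \<open>card I\<close> this is the symmetric multilinear form in \<open>x\<close> that takes the
value \<open>(card I)! P(v)\<close> when all \<open>x i\<close> are equal to \<open>v\<close>. The inclusion-exclusion formula makes it a finite
linear combination of values of \<open>P\<close>, so that it is defined for arbitrary functions and visibly
commutes with everything linear.\<close>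

definition polarization :: "'k set \<Rightarrow> ('v::comm_monoid_add \<Rightarrow> complex) \<Rightarrow> ('k \<Rightarrow> 'v) \<Rightarrow> complex" where
  "polarization I P x = (\<Sum>S\<in>Pow I. (-1) ^ card (I - S) * P (\<Sum>i\<in>S. x i))"

lemma polarization_0: "polarization I (\<lambda>_. 0) x = 0"
  and polarization_add: "polarization I (\<lambda>g. P g + Q g) x = polarization I P x + polarization I Q x"
  and polarization_cmult: "polarization I (\<lambda>g. c * P g) x = c * polarization I P x"
  by (simp_all add: polarization_def algebra_simps sum.distrib sum_distrib_left)

lemma sum_matrix_mult: "(\<Sum>i\<in>S. x i) ** h = (\<Sum>i\<in>S. x i ** h)" for h :: "'a::comm_ring_1^'m^'m::finite"
  by (induction S rule: infinite_finite_induct)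
    (auto simp: vec_eq_iff matrix_matrix_mult_def algebra_simps sum.distrib)

lemma polarization_translate:
  "polarization I (\<lambda>g. P (g ** h)) x = polarization I P (\<lambda>i. x i ** h)"
  for h :: "complex^'m^'m::finite"
  by (simp add: polarization_def sum_matrix_mult)

text \<open>Expand \<open>\<Prod>\<^sub>i\<^sub>\<in>\<^sub>I (1 - [i \<notin> T])\<close>.\<close>

lemma alternating_sum_supersets:
  assumes "finite I" "T \<subseteq> I"
  shows "(\<Sum>S\<in>Pow I. (-1) ^ card (I - S) * of_bool (T \<subseteq> S)) = (of_bool (T = I) :: complex)"
proof -
  have "of_bool (T = I) = (\<Prod>i\<in>I. 1 - of_bool (i \<notin> T) :: complex)"
    using assms by (auto simp: prod_zero_iff)
  also have "\<dots> = (\<Sum>S\<in>Pow I. (-1) ^ card (I - S) * (\<Prod>i\<in>S. 1) * (\<Prod>i\<in>I-S. of_bool (i \<notin> T)))"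
    unfolding prod_diff_conv_sum'[OF assms(1)]
    by (intro sum.cong refl) (simp add: card_Diff_subset[OF finite_subset[OF _ assms(1)]])
  also have "\<dots> = (\<Sum>S\<in>Pow I. (-1) ^ card (I - S) * of_bool (T \<subseteq> S))"
  proof (rule sum.cong[OF refl])
    fix S assume "S \<in> Pow I"
    then have "finite (I - S)" using assms by auto
    then have "(\<Prod>i\<in>I-S. of_bool (i \<notin> T)) = (of_bool (T \<subseteq> S) :: complex)"
      using assms by (cases "T \<subseteq> S") (auto intro!: prod.neutral prod_zero)
    then show "(-1) ^ card (I - S) * (\<Prod>i\<in>S. 1) * (\<Prod>i\<in>I-S. of_bool (i \<notin> T)) = (-1) ^ card (I - S) * (of_bool (T \<subseteq> S) :: complex)"
      by simp
  qed
  finally show ?thesis ..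
qed

text \<open>Expanding the product of sums gives one term for each map from \<open>I\<close> to \<open>I\<close>. The alternating sum
cancels all maps that are not surjective, and the surjective ones are the permutations.\<close>

lemma polarization_monomial:
  fixes x :: "'k \<Rightarrow> complex^'m^'m::finite"
  assumes I: "finite I"
  shows "polarization I (\<lambda>g. \<Prod>k\<in>I. g $ a k $ b k) x
    = (\<Sum>\<pi> | \<pi> permutes I. \<Prod>q\<in>I. x q $ a (\<pi> q) $ b (\<pi> q))"
proof -
  let ?F = "\<lambda>k i. x i $ a k $ b k"
  have "polarization I (\<lambda>g. \<Prod>k\<in>I. g $ a k $ b k) x
      = (\<Sum>S\<in>Pow I. (-1) ^ card (I - S) * (\<Prod>k\<in>I. \<Sum>i\<in>S. ?F k i))"
    by (simp add: polarization_def)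
  also have "\<dots> = (\<Sum>S\<in>Pow I. (-1) ^ card (I - S) * (\<Sum>f\<in>PiE I (\<lambda>_. S). \<Prod>k\<in>I. ?F k (f k)))"
    using I by (intro sum.cong arg_cong2[of _ _ _ _ "(*)"] prod_sum_PiE refl) (auto intro: finite_subset)
  also have "\<dots> = (\<Sum>S\<in>Pow I. \<Sum>f\<in>PiE I (\<lambda>_. I). (-1) ^ card (I - S) * of_bool (f ` I \<subseteq> S) * (\<Prod>k\<in>I. ?F k (f k)))"
  proof (rule sum.cong[OF refl])
    fix S assume S: "S \<in> Pow I"
    have "(\<Sum>f\<in>PiE I (\<lambda>_. S). \<Prod>k\<in>I. ?F k (f k)) = (\<Sum>f\<in>PiE I (\<lambda>_. I). of_bool (f ` I \<subseteq> S) * (\<Prod>k\<in>I. ?F k (f k)))"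
      using S I by (intro sum.mono_neutral_cong_left) (auto simp: PiE_iff image_subset_iff intro!: finite_PiE)
    then show "(-1) ^ card (I - S) * (\<Sum>f\<in>PiE I (\<lambda>_. S). \<Prod>k\<in>I. ?F k (f k))
      = (\<Sum>f\<in>PiE I (\<lambda>_. I). (-1) ^ card (I - S) * of_bool (f ` I \<subseteq> S) * (\<Prod>k\<in>I. ?F k (f k)))"
      by (simp add: sum_distrib_left mult.assoc)
  qed
  also have "\<dots> = (\<Sum>f\<in>PiE I (\<lambda>_. I). (\<Sum>S\<in>Pow I. (-1) ^ card (I - S) * of_bool (f ` I \<subseteq> S)) * (\<Prod>k\<in>I. ?F k (f k)))"
    by (subst sum.swap) (simp add: sum_distrib_right)
  also have "\<dots> = (\<Sum>f\<in>PiE I (\<lambda>_. I). of_bool (f ` I = I) * (\<Prod>k\<in>I. ?F k (f k)))"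
    using I by (intro sum.cong refl arg_cong2[of _ _ _ _ "(*)"] alternating_sum_supersets) auto
  also have "\<dots> = (\<Sum>f\<in>{f \<in> PiE I (\<lambda>_. I). f ` I = I}. \<Prod>k\<in>I. ?F k (f k))"
    using I by (intro sum.mono_neutral_cong_right) (auto intro!: finite_PiE)
  also have "\<dots> = (\<Sum>\<pi> | \<pi> permutes I. \<Prod>k\<in>I. ?F k (\<pi> k))"
  proof (rule sum.reindex_bij_witness[of _ "\<lambda>\<pi>. restrict \<pi> I" "\<lambda>f k. if k \<in> I then f k else k"])
    fix f assume f: "f \<in> {f \<in> PiE I (\<lambda>_. I). f ` I = I}"
    then have "bij_betw f I I" using I by (simp add: bij_betw_def eq_card_imp_inj_on)
    then have "bij_betw (\<lambda>k. if k \<in> I then f k else k) I I" by (rule bij_betw_cong[THEN iffD1, rotated]) simp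
    then show "(\<lambda>k. if k \<in> I then f k else k) \<in> {\<pi>. \<pi> permutes I}"
      by (auto intro: bij_imp_permutes)
  next
    fix \<pi> assume "\<pi> \<in> {\<pi>. \<pi> permutes I}"
    then show "restrict \<pi> I \<in> {f \<in> PiE I (\<lambda>_. I). f ` I = I}"
      by (auto simp: permutes_in_image permutes_image)
  qed (auto simp: PiE_iff extensional_def permutes_def)
  also have "\<dots> = (\<Sum>\<pi> | \<pi> permutes I. \<Prod>k\<in>I. ?F k (inv \<pi> k))"
    by (rule sum_permutations_inverse)
  also have "\<dots> = (\<Sum>\<pi> | \<pi> permutes I. \<Prod>q\<in>I. x q $ a (\<pi> q) $ b (\<pi> q))"
  proof (rule sum.cong[OF refl])
    fix \<pi> assume "\<pi> \<in> {\<pi>. \<pi> permutes I}"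
    then have \<pi>: "\<pi> permutes I" by simp
    show "(\<Prod>k\<in>I. ?F k (inv \<pi> k)) = (\<Prod>q\<in>I. x q $ a (\<pi> q) $ b (\<pi> q))"
      using prod.permute[OF \<pi>, of "\<lambda>k. ?F k (inv \<pi> k)"] permutes_inverses[OF \<pi>] by (simp add: o_def)
  qed
  finally show ?thesis .
qed

definition matrix_unit :: "'m \<Rightarrow> 'm \<Rightarrow> complex^'m^'m::finite" where
  "matrix_unit a b = (\<chi> r c. if r = a \<and> c = b then 1 else 0)"

text \<open>The terms of the Leibniz expansion of the \<open>E\<close>-th power of a determinant; \<open>family_sign\<close> gives their
signs.\<close>

definition perm_families :: "nat \<Rightarrow> (nat \<Rightarrow> 'm \<Rightarrow> 'm) set" where
  "perm_families E = PiE {..<E} (\<lambda>_. {p. p permutes UNIV})"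

definition family_sign :: "nat \<Rightarrow> (nat \<Rightarrow> 'm \<Rightarrow> 'm) \<Rightarrow> int" where
  "family_sign E \<sigma> = (\<Prod>j<E. sign (\<sigma> j))"

text \<open>This is \<open>det(\<partial>/\<partial>g)\<^sup>E P\<close> for a form \<open>P\<close> of degree \<open>E m\<close>: expanding the \<open>E\<close>-th power of the
determinant gives derivatives along \<open>E m\<close> matrix units, and on forms of that degree such an
iterated derivative is the polarization at these matrix units.\<close>

definition omega :: "nat \<Rightarrow> (complex^'m^'m::finite \<Rightarrow> complex) \<Rightarrow> complex" where
  "omega E P = (\<Sum>\<sigma>\<in>perm_families E. of_int (family_sign E \<sigma>) *
     polarization ({..<E} \<times> UNIV) P (\<lambda>(j, i). matrix_unit i (\<sigma> j i)))"

lemma finite_perm_families [simp]: "finite (perm_families E :: (nat \<Rightarrow> 'm::finite \<Rightarrow> 'm) set)"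
  unfolding perm_families_def by (intro finite_PiE) auto

lemma omega_0: "omega E (\<lambda>_. 0) = 0"
  and omega_add: "omega E (\<lambda>g. P g + Q g) = omega E P + omega E Q"
  and omega_cmult: "omega E (\<lambda>g. c * P g) = c * omega E P"
  by (simp_all add: omega_def polarization_0 polarization_add polarization_cmult
      algebra_simps sum.distrib sum_distrib_left)

lemma omega_sum: "omega E (\<lambda>g. \<Sum>k\<in>A. P k g) = (\<Sum>k\<in>A. omega E (P k))"
  by (induction A rule: infinite_finite_induct) (simp_all add: omega_0 omega_add)

lemma matrix_unit_mult: "(matrix_unit i s ** h) $ r $ c = (if r = i then h $ s $ c else 0)"
  by (simp add: matrix_unit_def matrix_matrix_mult_def if_distrib[of "\<lambda>x. x * _"] cong: if_cong)

text \<open>The product of a matrix unit \<open>(i, s)\<close> with \<open>h\<close> has the row \<open>s\<close> of \<open>h\<close> as its row \<open>i\<close> and is zero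
elsewhere. For a fixed permutation \<open>\<pi>\<close>, the sum over the \<open>j\<close>-th permutation of the family is
therefore the determinant of a 0-1 matrix times the transpose of \<open>h\<close>, and \<open>h\<close> contributes only
the factor \<open>det h\<close> for each \<open>j\<close>.\<close>

lemma omega_translate_monomial:
  fixes h :: "complex^'m^'m::finite"
  shows "omega E (\<lambda>g. \<Prod>k\<in>{..<E} \<times> UNIV. (g ** h) $ a k $ b k)
    = (\<Sum>\<pi> | \<pi> permutes {..<E} \<times> (UNIV :: 'm set). \<Prod>j<E.
        det (\<chi> i c. if a (\<pi> (j, i)) = i \<and> c = b (\<pi> (j, i)) then 1 else 0 :: complex^'m^'m)) * det h ^ E"
proof -
  let ?I = "{..<E} \<times> (UNIV :: 'm set)"
  let ?Pi = "{\<pi>. \<pi> permutes ?I}"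
  let ?G = "\<lambda>\<pi> j i s. if a (\<pi> (j, i)) = i then h $ s $ b (\<pi> (j, i)) else 0"
  let ?C = "\<lambda>\<pi> j. \<chi> i c. if a (\<pi> (j, i)) = i \<and> c = b (\<pi> (j, i)) then 1 else 0 :: complex^'m^'m"
  have "polarization ?I (\<lambda>g. \<Prod>k\<in>?I. (g ** h) $ a k $ b k) (\<lambda>(j, i). matrix_unit i (\<sigma> j i))
      = (\<Sum>\<pi>\<in>?Pi. \<Prod>j<E. \<Prod>i\<in>UNIV. ?G \<pi> j i (\<sigma> j i))" for \<sigma> :: "nat \<Rightarrow> 'm \<Rightarrow> 'm"
  proof -
    have "polarization ?I (\<lambda>g. \<Prod>k\<in>?I. (g ** h) $ a k $ b k) (\<lambda>(j, i). matrix_unit i (\<sigma> j i))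
      = (\<Sum>\<pi>\<in>?Pi. \<Prod>q\<in>?I. ((case q of (j, i) \<Rightarrow> matrix_unit i (\<sigma> j i)) ** h) $ a (\<pi> q) $ b (\<pi> q))"
      using polarization_translate[of ?I "\<lambda>g. \<Prod>k\<in>?I. g $ a k $ b k" h] polarization_monomial[of ?I a b]
      by simp
    also have "\<dots> = (\<Sum>\<pi>\<in>?Pi. \<Prod>(j, i)\<in>?I. ?G \<pi> j i (\<sigma> j i))"
      by (intro sum.cong prod.cong refl) (auto simp: matrix_unit_mult)
    finally show ?thesis by (simp add: prod.cartesian_product)
  qed
  then have "omega E (\<lambda>g. \<Prod>k\<in>?I. (g ** h) $ a k $ b k)
     = (\<Sum>\<sigma>\<in>perm_families E. \<Sum>\<pi>\<in>?Pi. \<Prod>j<E. of_int (sign (\<sigma> j)) * (\<Prod>i\<in>UNIV. ?G \<pi> j i (\<sigma> j i)))"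
    by (simp add: omega_def family_sign_def sum_distrib_left prod.distrib)
  also have "\<dots> = (\<Sum>\<pi>\<in>?Pi. \<Sum>\<sigma>\<in>perm_families E. \<Prod>j<E. of_int (sign (\<sigma> j)) * (\<Prod>i\<in>UNIV. ?G \<pi> j i (\<sigma> j i)))"
    by (rule sum.swap)
  also have "\<dots> = (\<Sum>\<pi>\<in>?Pi. \<Prod>j<E. \<Sum>p\<in>{p. p permutes UNIV}. of_int (sign p) * (\<Prod>i\<in>UNIV. ?G \<pi> j i (p i)))"
    unfolding perm_families_def by (intro sum.cong prod_sum_PiE[symmetric] refl) auto
  also have "\<dots> = (\<Sum>\<pi>\<in>?Pi. \<Prod>j<E. det (\<chi> i s. ?G \<pi> j i s))"
    by (simp add: det_def)
  also have "\<dots> = (\<Sum>\<pi>\<in>?Pi. \<Prod>j<E. det (?C \<pi> j) * det h)"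
  proof (intro sum.cong prod.cong refl)
    fix \<pi> j
    have "(\<chi> i s. ?G \<pi> j i s) = ?C \<pi> j ** transpose h"
      by (simp add: vec_eq_iff matrix_matrix_mult_def transpose_def if_distrib[of "\<lambda>x. x * _"] cong: if_cong)
    then show "det (\<chi> i s. ?G \<pi> j i s) = det (?C \<pi> j) * det h"
      by (simp add: det_mul)
  qed
  finally show ?thesis by (simp add: prod.distrib sum_distrib_right)
qed

lemma entry_mono_reindex:
  fixes xs :: "('m::finite \<times> 'm) list"
  assumes "finite I" "card I = length xs"
  shows "\<exists>a b. \<forall>g. entry_mono xs g = (\<Prod>k\<in>I. g $ a k $ b k)"
proof -
  obtain f where f: "bij_betw f I {..<length xs}"
    using assms finite_same_card_bij[of I "{..<length xs}"] by auto
  have "entry_mono xs g = (\<Prod>k\<in>I. g $ fst (xs ! f k) $ snd (xs ! f k))" for g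
  proof -
    have "entry_mono xs g = (\<Prod>n<length xs. g $ fst (xs ! n) $ snd (xs ! n))"
      by (simp add: entry_mono_def prod.list_conv_set_nth case_prod_beta atLeast0LessThan)
    then show ?thesis using prod.reindex_bij_betw[OF f, of "\<lambda>n. g $ fst (xs ! n) $ snd (xs ! n)"] by simp
  qed
  then show ?thesis by (intro exI allI)
qed

lemma omega_translate:
  fixes P :: "complex^'m^'m::finite \<Rightarrow> complex"
  assumes "entry_form (E * CARD('m)) P"
  shows "omega E (\<lambda>g. P (g ** h)) = det h ^ E * omega E P"
  using assms
proof (induction rule: entry_form.induct)
  case entry_form_0
  then show ?case by (simp add: omega_0)
next
  case (entry_form_step P xs c)
  have "card ({..<E} \<times> (UNIV :: 'm set)) = length xs"
    using entry_form_step.hyps by (simp add: card_cartesian_product)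
  then obtain a b :: "nat \<times> 'm \<Rightarrow> 'm"
    where ab: "\<And>g :: complex^'m^'m. entry_mono xs g = (\<Prod>k\<in>{..<E} \<times> UNIV. g $ a k $ b k)"
    using entry_mono_reindex[of "{..<E} \<times> (UNIV :: 'm set)" xs] by auto
  have "omega E (\<lambda>g. entry_mono xs (g ** h)) = det h ^ E * omega E (entry_mono xs)"
    using omega_translate_monomial[of E h a b] omega_translate_monomial[of E "mat 1" a b]
    by (simp add: ab[abs_def])
  then show ?case using entry_form_step.IH
    by (simp add: omega_add omega_cmult algebra_simps)
qed

lemma sum_squares_key:
  fixes \<epsilon> :: "'z \<Rightarrow> int"
  assumes "finite Z"
  shows "(\<Sum>y\<in>Z. \<Sum>z\<in>Z. \<epsilon> y * \<epsilon> z * of_bool (u y = u z)) = (\<Sum>t\<in>u ` Z. (\<Sum>z\<in>Z. \<epsilon> z * of_bool (u z = t))\<^sup>2)"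
proof -
  have "(\<Sum>t\<in>u ` Z. (\<Sum>z\<in>Z. \<epsilon> z * of_bool (u z = t))\<^sup>2) =
      (\<Sum>t\<in>u ` Z. \<Sum>y\<in>Z. \<Sum>z\<in>Z. \<epsilon> y * \<epsilon> z * (of_bool (u y = t) * of_bool (u z = t)))"
    by (simp add: power2_eq_square sum_product mult_ac)
  also have "\<dots> = (\<Sum>y\<in>Z. \<Sum>t\<in>u ` Z. \<Sum>z\<in>Z. \<epsilon> y * \<epsilon> z * (of_bool (u y = t) * of_bool (u z = t)))"
    by (rule sum.swap)
  also have "\<dots> = (\<Sum>y\<in>Z. \<Sum>z\<in>Z. \<Sum>t\<in>u ` Z. \<epsilon> y * \<epsilon> z * (of_bool (u y = t) * of_bool (u z = t)))"
    by (intro sum.cong refl sum.swap)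
  also have "\<dots> = (\<Sum>y\<in>Z. \<Sum>z\<in>Z. \<epsilon> y * \<epsilon> z * of_bool (u y = u z))"
  proof (intro sum.cong refl)
    fix y z assume "y \<in> Z" "z \<in> Z"
    have "(\<Sum>t\<in>u ` Z. \<epsilon> y * \<epsilon> z * (of_bool (u y = t) * of_bool (u z = t)))
       = (\<Sum>t\<in>u ` Z. if u y = t then \<epsilon> y * \<epsilon> z * of_bool (u y = u z) else 0)"
      by (intro sum.cong refl) auto
    also have "\<dots> = \<epsilon> y * \<epsilon> z * of_bool (u y = u z)"
      using assms \<open>y \<in> Z\<close> by (simp add: sum.delta)
    finally show "(\<Sum>t\<in>u ` Z. \<epsilon> y * \<epsilon> z * (of_bool (u y = t) * of_bool (u z = t))) = \<epsilon> y * \<epsilon> z * of_bool (u y = u z)" .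
  qed
  finally show ?thesis ..
qed

text \<open>Summing over a further permutation \<open>\<rho>\<close> only multiplies the pairing by \<open>(card I)!\<close>, but makes it
symmetric: it then counts coincidences between the functions \<open>s \<sigma> \<circ> \<rho>\<close> and \<open>s \<tau> \<circ> \<pi>\<close> on \<open>I\<close>, which
is a sum of squares. The square that belongs to the function \<open>s \<sigma>0\<close> is positive, because only \<open>\<sigma>0\<close>
contributes to it.\<close>

lemma permutation_pairing_pos:
  fixes \<epsilon> :: "'z \<Rightarrow> int" and s :: "'z \<Rightarrow> 'k \<Rightarrow> 'c"
  assumes fin: "finite \<Omega>" "finite I" and \<sigma>0: "\<sigma>0 \<in> \<Omega>" "\<epsilon> \<sigma>0 = 1"
    and uniq: "\<And>\<sigma> \<rho>. \<sigma> \<in> \<Omega> \<Longrightarrow> \<rho> permutes I \<Longrightarrow> (\<And>q. q \<in> I \<Longrightarrow> s \<sigma> (\<rho> q) = s \<sigma>0 q) \<Longrightarrow> \<sigma> = \<sigma>0"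
  shows "(\<Sum>\<sigma>\<in>\<Omega>. \<Sum>\<tau>\<in>\<Omega>. \<epsilon> \<sigma> * \<epsilon> \<tau> * (\<Sum>\<pi> | \<pi> permutes I. of_bool (\<forall>q\<in>I. s \<sigma> q = s \<tau> (\<pi> q)))) > 0"
    (is "?N > 0")
proof -
  let ?Pi = "{\<pi>. \<pi> permutes I}"
  let ?Z = "\<Omega> \<times> ?Pi"
  let ?u = "\<lambda>(\<sigma>, \<rho>). restrict (\<lambda>q. s \<sigma> (\<rho> q)) I"
  let ?e = "\<lambda>(\<sigma>, \<rho>). \<epsilon> \<sigma>"
  have finPi: "finite ?Pi" using fin by (simp add: finite_permutations)
  have *: "(\<Sum>\<pi>\<in>?Pi. of_bool (\<forall>q\<in>I. s \<sigma> q = s \<tau> (\<pi> q))) = (\<Sum>\<pi>\<in>?Pi. of_bool (?u (\<sigma>, \<rho>) = ?u (\<tau>, \<pi>)) :: int)"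
    if "\<rho> \<in> ?Pi" for \<rho> \<sigma> \<tau>
  proof -
    have \<rho>: "\<rho> permutes I" using that by simp
    have "(\<Sum>\<pi>\<in>?Pi. of_bool (?u (\<sigma>, \<rho>) = ?u (\<tau>, \<pi>)) :: int) = (\<Sum>\<pi>\<in>?Pi. of_bool (?u (\<sigma>, \<rho>) = ?u (\<tau>, \<pi> \<circ> \<rho>)))"
      by (rule sum_permutations_compose_right[OF \<rho>])
    also have "\<dots> = (\<Sum>\<pi>\<in>?Pi. of_bool (\<forall>q\<in>I. s \<sigma> q = s \<tau> (\<pi> q)))"
    proof (intro sum.cong refl arg_cong[of _ _ of_bool])
      fix \<pi>
      have "?u (\<sigma>, \<rho>) = ?u (\<tau>, \<pi> \<circ> \<rho>) \<longleftrightarrow> (\<forall>q\<in>I. s \<sigma> (\<rho> q) = s \<tau> (\<pi> (\<rho> q)))"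
        by (auto simp: restrict_def fun_eq_iff)
      also have "\<dots> \<longleftrightarrow> (\<forall>q\<in>\<rho> ` I. s \<sigma> q = s \<tau> (\<pi> q))" by blast
      finally show "(?u (\<sigma>, \<rho>) = ?u (\<tau>, \<pi> \<circ> \<rho>)) = (\<forall>q\<in>I. s \<sigma> q = s \<tau> (\<pi> q))"
        by (simp add: permutes_image[OF \<rho>])
    qed
    finally show ?thesis ..
  qed
  have "int (card ?Pi) * ?N = (\<Sum>\<rho>\<in>?Pi. ?N)" by simp
  also have "\<dots> = (\<Sum>\<rho>\<in>?Pi. \<Sum>\<sigma>\<in>\<Omega>. \<Sum>\<tau>\<in>\<Omega>. \<Sum>\<pi>\<in>?Pi. \<epsilon> \<sigma> * \<epsilon> \<tau> * of_bool (?u (\<sigma>, \<rho>) = ?u (\<tau>, \<pi>)))"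
  proof (intro sum.cong refl)
    fix \<rho> \<sigma> \<tau> assume "\<rho> \<in> ?Pi"
    show "\<epsilon> \<sigma> * \<epsilon> \<tau> * (\<Sum>\<pi>\<in>?Pi. of_bool (\<forall>q\<in>I. s \<sigma> q = s \<tau> (\<pi> q)))
        = (\<Sum>\<pi>\<in>?Pi. \<epsilon> \<sigma> * \<epsilon> \<tau> * of_bool (?u (\<sigma>, \<rho>) = ?u (\<tau>, \<pi>)))"
      by (subst *[OF \<open>\<rho> \<in> ?Pi\<close>]) (rule sum_distrib_left)
  qed
  also have "\<dots> = (\<Sum>\<sigma>\<in>\<Omega>. \<Sum>\<rho>\<in>?Pi. \<Sum>\<tau>\<in>\<Omega>. \<Sum>\<pi>\<in>?Pi. \<epsilon> \<sigma> * \<epsilon> \<tau> * of_bool (?u (\<sigma>, \<rho>) = ?u (\<tau>, \<pi>)))"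
    by (rule sum.swap)
  also have "\<dots> = (\<Sum>y\<in>?Z. \<Sum>z\<in>?Z. ?e y * ?e z * of_bool (?u y = ?u z))"
    by (simp only: sum.cartesian_product' prod.case)
  also have "\<dots> = (\<Sum>t\<in>?u ` ?Z. (\<Sum>z\<in>?Z. ?e z * of_bool (?u z = t))\<^sup>2)"
    using fin finPi by (intro sum_squares_key) auto
  also have "\<dots> > 0"
  proof (rule sum_pos2[of _ "?u (\<sigma>0, id)"])
    show "finite (?u ` ?Z)" using fin finPi by auto
    have z0: "(\<sigma>0, id) \<in> ?Z" using \<sigma>0 by (simp add: permutes_id)
    then show "?u (\<sigma>0, id) \<in> ?u ` ?Z" by (rule imageI)
    have "(\<Sum>z\<in>?Z. ?e z * of_bool (?u z = ?u (\<sigma>0, id))) > 0"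
    proof (rule sum_pos2[of _ "(\<sigma>0, id)"])
      show "finite ?Z" using fin finPi by auto
      show "(\<sigma>0, id) \<in> ?Z" by (rule z0)
      show "0 < ?e (\<sigma>0, id) * of_bool (?u (\<sigma>0, id) = ?u (\<sigma>0, id))" using \<sigma>0 by simp
      fix z assume "z \<in> ?Z"
      then obtain \<sigma> \<rho> where z: "z = (\<sigma>, \<rho>)" "\<sigma> \<in> \<Omega>" "\<rho> permutes I" by auto
      show "0 \<le> ?e z * of_bool (?u z = ?u (\<sigma>0, id))"
      proof (cases "?u z = ?u (\<sigma>0, id)")
        case True
        have "s \<sigma> (\<rho> q) = s \<sigma>0 q" if "q \<in> I" for q
          using that fun_cong[OF True, of q] z by simp
        then have "\<sigma> = \<sigma>0" using uniq z by blast
        then show ?thesis using \<sigma>0 z by simp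
      qed simp
    qed
    then show "0 < (\<Sum>z\<in>?Z. ?e z * of_bool (?u z = ?u (\<sigma>0, id)))\<^sup>2" by simp
  qed simp
  finally show ?thesis by (simp add: zero_less_mult_iff)
qed

text \<open>The value is the pairing of \<open>det\<^sup>E\<close> with itself in which distinct monomials are orthogonal, and the
coefficients are integers. The monomial \<open>(\<Prod>\<^sub>i g\<^sub>i\<^sub>i)\<^sup>E\<close> arises from the family of identity
permutations only, so its coefficient is not zero.\<close>

lemma omega_det_power_nonzero: "omega E (\<lambda>g. det (g :: complex^'m^'m::finite) ^ E) \<noteq> 0"
proof -
  let ?I = "{..<E} \<times> (UNIV :: 'm set)"
  let ?\<Omega> = "perm_families E :: (nat \<Rightarrow> 'm \<Rightarrow> 'm) set"
  let ?s = "\<lambda>\<sigma> (q :: nat \<times> 'm). (snd q, \<sigma> (fst q) (snd q))"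
  let ?N = "(\<Sum>\<sigma>\<in>?\<Omega>. \<Sum>\<tau>\<in>?\<Omega>. family_sign E \<sigma> * family_sign E \<tau> *
      (\<Sum>\<pi> | \<pi> permutes ?I. of_bool (\<forall>q\<in>?I. ?s \<sigma> q = ?s \<tau> (\<pi> q))))"
  have det: "det g ^ E = (\<Sum>\<tau>\<in>?\<Omega>. of_int (family_sign E \<tau>) * (\<Prod>k\<in>?I. g $ snd k $ \<tau> (fst k) (snd k)))"
    for g :: "complex^'m^'m"
  proof -
    have "det g ^ E = (\<Prod>j<E. \<Sum>p | p permutes UNIV. of_int (sign p) * (\<Prod>i\<in>UNIV. g $ i $ p i))"
      by (simp add: det_def)
    also have "\<dots> = (\<Sum>\<tau>\<in>?\<Omega>. \<Prod>j<E. of_int (sign (\<tau> j)) * (\<Prod>i\<in>UNIV. g $ i $ \<tau> j i))"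
      unfolding perm_families_def by (rule prod_sum_PiE) auto
    also have "\<dots> = (\<Sum>\<tau>\<in>?\<Omega>. of_int (family_sign E \<tau>) * (\<Prod>j<E. \<Prod>i\<in>UNIV. g $ i $ \<tau> j i))"
      by (simp add: prod.distrib family_sign_def)
    finally show ?thesis by (simp add: prod.cartesian_product case_prod_beta)
  qed
  have mono: "omega E (\<lambda>g. \<Prod>k\<in>?I. g $ snd k $ \<tau> (fst k) (snd k)) =
      (\<Sum>\<sigma>\<in>?\<Omega>. of_int (family_sign E \<sigma>) * of_int (\<Sum>\<pi> | \<pi> permutes ?I. of_bool (\<forall>q\<in>?I. ?s \<sigma> q = ?s \<tau> (\<pi> q))))"
    for \<tau> :: "nat \<Rightarrow> 'm \<Rightarrow> 'm"
  proof -
    have "(\<Prod>q\<in>?I. (case q of (j, i) \<Rightarrow> matrix_unit i (\<sigma> j i)) $ snd (\<pi> q) $ \<tau> (fst (\<pi> q)) (snd (\<pi> q)))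
      = of_bool (\<forall>q\<in>?I. ?s \<sigma> q = ?s \<tau> (\<pi> q))" for \<sigma> \<pi>
    proof -
      have "(\<Prod>q\<in>?I. (case q of (j, i) \<Rightarrow> matrix_unit i (\<sigma> j i)) $ snd (\<pi> q) $ \<tau> (fst (\<pi> q)) (snd (\<pi> q)))
         = (\<Prod>q\<in>?I. of_bool (?s \<sigma> q = ?s \<tau> (\<pi> q)))"
        by (intro prod.cong refl) (auto simp: matrix_unit_def)
      also have "\<dots> = of_bool (\<forall>q\<in>?I. ?s \<sigma> q = ?s \<tau> (\<pi> q))"
        by (cases "\<forall>q\<in>?I. ?s \<sigma> q = ?s \<tau> (\<pi> q)") (auto intro!: prod_zero prod.neutral)
      finally show ?thesis .
    qed
    then show ?thesis
      unfolding omega_def by (subst polarization_monomial) simp_all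
  qed
  have "omega E (\<lambda>g. det (g :: complex^'m^'m) ^ E)
     = (\<Sum>\<tau>\<in>?\<Omega>. of_int (family_sign E \<tau>) * omega E (\<lambda>g :: complex^'m^'m. \<Prod>k\<in>?I. g $ snd k $ \<tau> (fst k) (snd k)))"
    unfolding det omega_sum omega_cmult ..
  also have "\<dots> = of_int ?N"
    unfolding mono by (subst sum.swap) (simp add: sum_distrib_left mult_ac)
  finally have "omega E (\<lambda>g. det (g :: complex^'m^'m) ^ E) = of_int ?N" .
  moreover have "?N > 0"
  proof (rule permutation_pairing_pos[of _ _ "restrict (\<lambda>_. id) {..<E}"])
    show "restrict (\<lambda>_. id) {..<E} \<in> ?\<Omega>" by (auto simp: perm_families_def permutes_id)
    show "family_sign E (restrict (\<lambda>_. id) {..<E}) = 1" by (simp add: family_sign_def sign_id)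
    fix \<sigma> :: "nat \<Rightarrow> 'm \<Rightarrow> 'm" and \<rho>
    assume \<sigma>: "\<sigma> \<in> ?\<Omega>" and \<rho>: "\<rho> permutes ?I"
      and eq: "\<And>q. q \<in> ?I \<Longrightarrow> ?s \<sigma> (\<rho> q) = ?s (restrict (\<lambda>_. id) {..<E}) q"
    have "\<sigma> j i = i" if "j < E" for j i
    proof -
      have "(j, i) \<in> \<rho> ` ?I" using that permutes_image[OF \<rho>] by simp
      then obtain q where "q \<in> ?I" "\<rho> q = (j, i)" by force
      then show ?thesis using eq[of q] by auto
    qed
    then show "\<sigma> = restrict (\<lambda>_. id) {..<E}"
      using \<sigma> by (auto simp: perm_families_def PiE_iff extensional_def fun_eq_iff)
  qed simp_all
  then have "?N \<noteq> 0" by (rule less_imp_neq[symmetric])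
  ultimately show ?thesis
    by (simp only: of_int_eq_0_iff simp_thms)
qed

section \<open>Homogeneous components along an orbit\<close>

text \<open>Polynomials in other variables whose coefficients are forms of degree \<open>n\<close> in the entries of \<open>g\<close>.\<close>

inductive entry_family :: "nat \<Rightarrow> (complex^'m^'m::finite \<Rightarrow> 'x cpoly) \<Rightarrow> bool" for n where
  entry_family_0: "entry_family n (\<lambda>_. 0)"
| entry_family_step: "entry_family n Q \<Longrightarrow> entry_form n P \<Longrightarrow> entry_family n (\<lambda>g. Q g + Const (P g) * q)"

lemma entry_family_single: "entry_form n P \<Longrightarrow> entry_family n (\<lambda>g. Const (P g) * q)"
  using entry_family_step[OF entry_family_0] by fastforce

lemma entry_family_const: "entry_family 0 (\<lambda>_. q)"
  using entry_family_single[OF entry_form_const, of 1 q] by simp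

lemma entry_family_add: "entry_family n R \<Longrightarrow> entry_family n Q \<Longrightarrow> entry_family n (\<lambda>g. Q g + R g)"
  by (induction rule: entry_family.induct) (auto simp flip: add.assoc intro: entry_family_step)

lemma entry_family_sum: "(\<And>k. k \<in> A \<Longrightarrow> entry_family n (Q k)) \<Longrightarrow> entry_family n (\<lambda>g. \<Sum>k\<in>A. Q k g)"
  by (induction A rule: infinite_finite_induct) (auto intro: entry_family_0 entry_family_add)

lemma entry_family_mult_single:
  "entry_family n Q \<Longrightarrow> entry_form k P \<Longrightarrow> entry_family (n + k) (\<lambda>g. Q g * (Const (P g) * q))"
proof (induction rule: entry_family.induct)
  case (entry_family_step Q R r)
  have "(\<lambda>g. (Q g + Const (R g) * r) * (Const (P g) * q)) =
     (\<lambda>g. Q g * (Const (P g) * q) + Const (R g * P g) * (r * q))"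
    by (simp add: fun_eq_iff Const_mult algebra_simps)
  then show ?case using entry_family_step by (auto intro: entry_family.entry_family_step entry_form_mult)
qed (auto intro: entry_family_0)

lemma entry_family_mult: "entry_family k R \<Longrightarrow> entry_family n Q \<Longrightarrow> entry_family (n + k) (\<lambda>g. Q g * R g)"
  by (induction rule: entry_family.induct) (auto simp: distrib_left intro: entry_family_0 entry_family_add entry_family_mult_single)

lemma entry_family_power: "entry_family n Q \<Longrightarrow> entry_family (k * n) (\<lambda>g. Q g ^ k)"
  by (induction k) (auto intro: entry_family_const[of 1, simplified] entry_family_mult)

lemma entry_family_prod:
  "finite A \<Longrightarrow> (\<And>k. k \<in> A \<Longrightarrow> entry_family (n k) (Q k)) \<Longrightarrow> entry_family (\<Sum>k\<in>A. n k) (\<lambda>g. \<Prod>k\<in>A. Q k g)"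
proof (induction A rule: finite_induct)
  case empty then show ?case using entry_family_const[of 1] by simp
next
  case (insert a A)
  have "entry_family (n a + (\<Sum>k\<in>A. n k)) (\<lambda>g. Q a g * (\<Prod>k\<in>A. Q k g))"
    using insert by (intro entry_family_mult) auto
  then show ?case using insert by simp
qed

lemma entry_family_lookup: "entry_family n Q \<Longrightarrow> entry_form n (\<lambda>g. Poly_Mapping.lookup (Q g) \<nu>)"
proof (induction rule: entry_family.induct)
  case (entry_family_step Q P q)
  have "entry_form n (\<lambda>g. Poly_Mapping.lookup q \<nu> * P g)" using entry_family_step by (intro entry_form_cmult)
  then show ?case using entry_form_add[OF _ entry_family_step.IH, of "\<lambda>g. Poly_Mapping.lookup q \<nu> * P g"]
    by (simp add: lookup_add lookup_Const_mult mult.commute[of "Poly_Mapping.lookup q \<nu>"])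
qed (auto intro: entry_form_0)

lemma entry_family_act:
  fixes v :: "'m::finite cpoly"
  assumes "v \<in> forms D"
  shows "entry_family D (\<lambda>g. act g v)"
proof -
  have lin: "entry_family 1 (\<lambda>g. \<Sum>i\<in>UNIV. Const (g $ i $ j) * Var i)" for j :: 'm
    by (intro entry_family_sum entry_family_single entry_form_entry)
  have pow: "entry_family n (\<lambda>g. (\<Sum>i\<in>UNIV. Const (g $ i $ j) * Var i) ^ n)" for j :: 'm and n
    using entry_family_power[OF lin, of n] by simp
  have "entry_family D (\<lambda>g. act g (Poly_Mapping.single \<mu> c))" if "\<mu> \<in> monomials D" for \<mu> :: "'m \<Rightarrow>\<^sub>0 nat" and c
  proof -
    have "entry_family (\<Sum>i\<in>Poly_Mapping.keys \<mu>. Poly_Mapping.lookup \<mu> i)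
       (\<lambda>g. mono_val (\<lambda>j. \<Sum>i\<in>UNIV. Const (g $ i $ j) * Var i) \<mu>)"
      unfolding mono_val_def by (rule entry_family_prod[OF _ pow]) simp
    then have "entry_family D (\<lambda>g. mono_val (\<lambda>j. \<Sum>i\<in>UNIV. Const (g $ i $ j) * Var i) \<mu>)"
      using that by (simp add: sum_lookup_keys monomials_def)
    from entry_family_mult[OF this entry_family_const[of "Const c"]] show ?thesis
      by (simp add: act_single)
  qed
  moreover have "act g v = (\<Sum>\<mu>\<in>Poly_Mapping.keys v. act g (Poly_Mapping.single \<mu> (Poly_Mapping.lookup v \<mu>)))" for g
    using cpoly_eq_sum_single[of v] by (metis act_sum)
  ultimately show ?thesis using assms by (auto simp: forms_iff intro!: entry_family_sum)
qed

definition monomial_degree :: "('x \<Rightarrow>\<^sub>0 nat) \<Rightarrow> nat" where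
  "monomial_degree \<mu> = (\<Sum>i\<in>Poly_Mapping.keys \<mu>. Poly_Mapping.lookup \<mu> i)"

definition homogeneous_part :: "nat \<Rightarrow> 'x cpoly \<Rightarrow> 'x cpoly" where
  "homogeneous_part d p = (\<Sum>\<mu> | \<mu> \<in> Poly_Mapping.keys p \<and> monomial_degree \<mu> = d. Poly_Mapping.single \<mu> (Poly_Mapping.lookup p \<mu>))"

lemma peval_single: "peval a (Poly_Mapping.single \<mu> c) = c * mono_val a \<mu>"
  by (simp add: peval_eq poly_val_single[OF scalar_hom_id])

lemma polyfun_homogeneous_part:
  "polyfun (homogeneous_part d p) v = (\<Sum>\<mu> | \<mu> \<in> Poly_Mapping.keys p \<and> monomial_degree \<mu> = d.
     Poly_Mapping.lookup p \<mu> * mono_val (Poly_Mapping.lookup v) \<mu>)"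
  by (simp add: polyfun_def homogeneous_part_def peval_single)

lemma polyfun_homogeneous_part_scale: "polyfun (homogeneous_part d p) (Const t * v) = t ^ d * polyfun (homogeneous_part d p) v"
proof -
  have "mono_val (Poly_Mapping.lookup (Const t * v)) \<mu> = t ^ monomial_degree \<mu> * mono_val (Poly_Mapping.lookup v) \<mu>" for \<mu>
    by (simp add: mono_val_def lookup_Const_mult power_mult_distrib prod.distrib monomial_degree_def power_sum)
  then show ?thesis by (simp add: polyfun_homogeneous_part sum_distrib_left mult_ac)
qed

lemma polyfun_eq_sum_homogeneous_part: "\<exists>N. \<forall>v. polyfun p v = (\<Sum>d\<le>N. polyfun (homogeneous_part d p) v)"
proof -
  define N where "N = (\<Sum>\<mu>\<in>Poly_Mapping.keys p. monomial_degree \<mu>)"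
  have N: "monomial_degree \<mu> \<le> N" if "\<mu> \<in> Poly_Mapping.keys p" for \<mu>
    unfolding N_def using that by (intro member_le_sum) auto
  have "polyfun p v = (\<Sum>d\<le>N. polyfun (homogeneous_part d p) v)" for v
  proof -
    have "polyfun p v = (\<Sum>\<mu>\<in>Poly_Mapping.keys p. Poly_Mapping.lookup p \<mu> * mono_val (Poly_Mapping.lookup v) \<mu>)"
      by (simp add: polyfun_def peval_eq poly_val_def)
    also have "\<dots> = (\<Sum>d\<le>N. \<Sum>\<mu> | \<mu> \<in> Poly_Mapping.keys p \<and> monomial_degree \<mu> = d. Poly_Mapping.lookup p \<mu> * mono_val (Poly_Mapping.lookup v) \<mu>)"
      by (rule sum.group[symmetric]) (use N in auto)
    finally show ?thesis by (simp add: polyfun_homogeneous_part)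
  qed
  then show ?thesis by blast
qed

lemma entry_form_polyfun_act:
  assumes "v \<in> forms D"
  shows "entry_form (D * d) (\<lambda>g. polyfun (homogeneous_part d p) (act g v))"
proof -
  have "entry_form (D * d) (\<lambda>g. mono_val (Poly_Mapping.lookup (act g v)) \<mu>)" if "monomial_degree \<mu> = d" for \<mu>
  proof -
    have "entry_form (\<Sum>\<nu>\<in>Poly_Mapping.keys \<mu>. Poly_Mapping.lookup \<mu> \<nu> * D)
       (\<lambda>g. mono_val (Poly_Mapping.lookup (act g v)) \<mu>)"
      unfolding mono_val_def
      by (intro entry_form_prod entry_form_power entry_family_lookup entry_family_act assms) simp
    moreover have "(\<Sum>\<nu>\<in>Poly_Mapping.keys \<mu>. Poly_Mapping.lookup \<mu> \<nu> * D) = D * d"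
      using that by (simp add: monomial_degree_def flip: sum_distrib_right)
    ultimately show ?thesis by simp
  qed
  then show ?thesis unfolding polyfun_homogeneous_part by (intro entry_form_sum entry_form_cmult) auto
qed

section \<open>Polynomial functions on the space of forms\<close>

text \<open>Averaging produces functions and not polynomials; this is the property of functions that has to be
carried along.\<close>

definition poly_on :: "nat \<Rightarrow> ('m::finite cpoly \<Rightarrow> complex) \<Rightarrow> bool" where
  "poly_on D f \<longleftrightarrow> (\<exists>q. \<forall>v\<in>forms D. f v = polyfun q v)"

lemma poly_on_add: "poly_on D f \<Longrightarrow> poly_on D h \<Longrightarrow> poly_on D (\<lambda>v. f v + h v)"
proof -
  assume "poly_on D f" "poly_on D h"
  then obtain p q where "\<forall>v\<in>forms D. f v = polyfun p v" "\<forall>v\<in>forms D. h v = polyfun q v"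
    by (auto simp: poly_on_def)
  then show ?thesis unfolding poly_on_def by (intro exI[of _ "p + q"]) (simp add: polyfun_def)
qed

lemma poly_on_0: "poly_on D (\<lambda>_. 0)"
  unfolding poly_on_def by (rule exI[of _ 0]) (simp add: polyfun_def)

lemma poly_on_cmult: "poly_on D f \<Longrightarrow> poly_on D (\<lambda>v. c * f v)"
proof -
  assume "poly_on D f"
  then obtain p where "\<forall>v\<in>forms D. f v = polyfun p v"
    by (auto simp: poly_on_def)
  then show ?thesis unfolding poly_on_def by (intro exI[of _ "Const c * p"]) (simp add: polyfun_def)
qed

lemma poly_on_sum: "(\<And>k. k \<in> A \<Longrightarrow> poly_on D (f k)) \<Longrightarrow> poly_on D (\<lambda>v. \<Sum>k\<in>A. f k v)"
  by (induction A rule: infinite_finite_induct) (auto intro: poly_on_add poly_on_0)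

text \<open>The coefficients of \<open>g v\<close> are linear in those of \<open>v\<close>. The sum over all monomials of degree \<open>D\<close>, and
not only over those in \<open>v\<close>, makes the linear form independent of \<open>v\<close>.\<close>

lemma lookup_act:
  assumes "v \<in> forms D"
  shows "Poly_Mapping.lookup (act g v) \<nu> = (\<Sum>\<mu>\<in>monomials D. Poly_Mapping.lookup v \<mu> * Poly_Mapping.lookup (act g (Poly_Mapping.single \<mu> 1)) \<nu>)"
  unfolding act_eq_sum[of g v] lookup_sum lookup_Const_mult
  using assms by (intro sum.mono_neutral_left) (auto simp: forms_iff in_keys_iff)

lemma poly_on_polyfun_act: "poly_on D (\<lambda>v. polyfun p (act g v))"
  unfolding poly_on_def
proof (intro exI ballI)
  fix v :: "'a cpoly" assume "v \<in> forms D"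
  then have "Poly_Mapping.lookup (act g v) = (\<lambda>\<nu>. \<Sum>\<mu>\<in>monomials D.
      Poly_Mapping.lookup v \<mu> * Poly_Mapping.lookup (act g (Poly_Mapping.single \<mu> 1)) \<nu>)"
    by (intro ext lookup_act)
  then show "polyfun p (act g v) = polyfun (psubst (\<lambda>\<nu>. \<Sum>\<mu>\<in>monomials D.
     Const (Poly_Mapping.lookup (act g (Poly_Mapping.single \<mu> 1)) \<nu>) * Var \<mu>) p) v"
    by (simp add: polyfun_def peval_psubst mult.commute)
qed

lemma poly_on_polyfun_scale: "poly_on D (\<lambda>v. polyfun p (Const t * v))"
  unfolding poly_on_def
proof (intro exI ballI)
  fix v :: "'a cpoly"
  have "Poly_Mapping.lookup (Const t * v) = (\<lambda>\<nu>. t * Poly_Mapping.lookup v \<nu>)"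
    by (intro ext lookup_Const_mult)
  then show "polyfun p (Const t * v) = polyfun (psubst (\<lambda>\<nu>. Const t * Var \<nu>) p) v"
    by (simp add: polyfun_def peval_psubst)
qed

lemma poly_on_omega:
  assumes "\<And>g. poly_on D (\<lambda>v. F v g)"
  shows "poly_on D (\<lambda>v. omega E (F v))"
  unfolding omega_def polarization_def by (intro poly_on_sum poly_on_cmult assms)

section \<open>Averaging over the special linear group\<close>

lemma det_mat_mult: "det (mat c ** g) = c ^ CARD('m) * det g" for g :: "complex^'m^'m::finite"
proof -
  have "mat c ** g = (\<chi> i. c *s g $ i)"
    by (simp add: vec_eq_iff matrix_matrix_mult_def mat_def if_distrib[of "\<lambda>x. x * _"] cong: if_cong)
  then show ?thesis using det_rows_mul[of "\<lambda>_. c" "\<lambda>i. g $ i"] by simp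
qed

text \<open>On the line through the identity and \<open>g\<close> the determinant is a nonzero polynomial in the
parameter. So only finitely many points of the line are singular, and \<open>g\<close> is a limit of the others.\<close>

lemma continuous_eq_if_eq_on_invertible:
  fixes f h :: "complex^'m^'m::finite \<Rightarrow> complex"
  assumes "continuous_on UNIV f" "continuous_on UNIV h" and eq: "\<And>g. det g \<noteq> 0 \<Longrightarrow> f g = h g"
  shows "f g = h g"
proof -
  define \<gamma> :: "complex \<Rightarrow> complex^'m^'m" where
    "\<gamma> t = (\<chi> i j. mat 1 $ i $ j + t * (g $ i $ j - mat 1 $ i $ j))" for t
  define p where "p = (\<Sum>\<sigma> | \<sigma> permutes (UNIV :: 'm set). [:of_int (sign \<sigma>):] *
      (\<Prod>i\<in>UNIV. [:mat 1 $ i $ \<sigma> i, g $ i $ \<sigma> i - (mat 1 :: complex^'m^'m) $ i $ \<sigma> i:]))"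
  have p: "poly p t = det (\<gamma> t)" for t
    by (simp add: p_def \<gamma>_def det_def poly_sum poly_prod)
  have "\<gamma> 0 = mat 1" "\<gamma> 1 = g" by (simp_all add: \<gamma>_def vec_eq_iff)
  then have "p \<noteq> 0" using p[of 0] by auto
  then have fin: "finite {t. poly p t = 0}" by (rule poly_roots_finite)
  have "closure (- {t. poly p t = 0}) = UNIV"
    unfolding closure_complement using fin by (simp add: empty_interior_finite)
  moreover have "continuous_on UNIV (\<lambda>t. f (\<gamma> t) - h (\<gamma> t))"
  proof -
    have "continuous_on UNIV \<gamma>" unfolding \<gamma>_def by (intro continuous_intros)
    then show ?thesis using assms(1,2)
      by (intro continuous_on_diff continuous_on_compose2[of UNIV f UNIV \<gamma>] continuous_on_compose2[of UNIV h UNIV \<gamma>]) auto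
  qed
  moreover have "f (\<gamma> t) - h (\<gamma> t) = 0" if "t \<in> - {t. poly p t = 0}" for t
    using that eq[of "\<gamma> t"] p by simp
  ultimately have "f (\<gamma> 1) - h (\<gamma> 1) = 0"
    using continuous_constant_on_closure[of "- {t. poly p t = 0}" "\<lambda>t. f (\<gamma> t) - h (\<gamma> t)" 0 1] by simp
  then show ?thesis using \<open>\<gamma> 1 = g\<close> by simp
qed

lemma ex_nth_root: "n > 0 \<Longrightarrow> \<exists>t::complex. t ^ n = z"
proof (cases "z = 0")
  case False
  assume "n > 0"
  then have "card {t. t ^ n = z} = n" using False by (intro card_nth_roots)
  then have "{t. t ^ n = z} \<noteq> {}" using \<open>n > 0\<close> by force
  then show ?thesis by blast
qed auto

text \<open>Otherwise all \<open>m\<close> roots of unity would be zeros of \<open>u\<^sup>r - 1\<close>, where \<open>r\<close> is the remainder of \<open>k\<close>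
modulo \<open>m\<close>, and \<open>0 < r < m\<close>.\<close>

lemma ex_root_unity_power_neq_1:
  assumes "m > 0" "\<not> m dvd k"
  shows "\<exists>u::complex. u ^ m = 1 \<and> u ^ k \<noteq> 1"
proof (rule ccontr)
  assume no: "\<nexists>u::complex. u ^ m = 1 \<and> u ^ k \<noteq> 1"
  have r: "0 < k mod m" "k mod m < m"
    using assms by (auto simp: mod_eq_0_iff_dvd intro: Nat.gr0I)
  have "u ^ (k mod m) = 1" if "u ^ m = 1" for u :: complex
  proof -
    have "u ^ k = (u ^ m) ^ (k div m) * u ^ (k mod m)" by (simp flip: power_mult power_add)
    then show ?thesis using no that by auto
  qed
  then have "card {u::complex. u ^ m = 1} \<le> card {u::complex. u ^ (k mod m) = 1}"
    using r by (intro card_mono finite_roots_unity) auto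
  then show False using r assms by (simp add: card_roots_unity_eq)
qed

lemma sum_roots_unity_inverse_power:
  assumes "m > 0"
  shows "(\<Sum>z | z ^ m = (1::complex). inverse z ^ k) = (if m dvd k then of_nat m else 0)"
proof (cases "m dvd k")
  case True
  then obtain l where "k = m * l" ..
  then have "inverse z ^ k = 1" if "z ^ m = 1" for z :: complex
    using that by (simp add: power_mult power_inverse)
  then show ?thesis using True card_roots_unity_eq[OF assms] by simp
next
  case False
  then obtain u :: complex where u: "u ^ m = 1" "u ^ k \<noteq> 1"
    using ex_root_unity_power_neq_1[OF assms] by blast
  then have "u \<noteq> 0" using assms by (auto simp: power_0_left)
  let ?S = "\<Sum>z | z ^ m = (1::complex). inverse z ^ k"
  have "?S = (\<Sum>z | z ^ m = (1::complex). inverse (z / u) ^ k)"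
    by (rule sum.reindex_bij_witness[of _ "\<lambda>z. z / u" "\<lambda>z. z * u"])
      (use u \<open>u \<noteq> 0\<close> in \<open>auto simp: power_mult_distrib power_divide\<close>)
  also have "\<dots> = u ^ k * ?S"
    by (simp add: sum_distrib_left power_divide power_inverse divide_inverse mult.commute power_mult_distrib)
  finally show ?thesis using u False by simp
qed

text \<open>\<open>J d\<close> is the average of the component of degree \<open>d\<close> of \<open>p\<close>. If \<open>p\<close> has the constant value \<open>\<kappa>\<close>
on the translate \<open>c Y\<close> of the orbit \<open>Y\<close> of \<open>w\<close>, then so has its average, and \<open>J d\<close> takes the value
\<open>c\<^sup>d J d w\<close> there. It is essential that the same functions \<open>J d\<close> serve all \<open>c\<close>: comparing two
translates then compares two values of one polynomial in \<open>c\<close>.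

Let \<open>p\<^sub>d\<close> be the component of degree \<open>d\<close>. The function \<open>g \<mapsto> p\<^sub>d(g w)\<close> has degree \<open>D d\<close>. If \<open>m\<close> divides
\<open>D d\<close>, then a power of the determinant raises this degree to the common value \<open>m E\<close> to which \<open>omega\<close>
applies. The other components cancel when \<open>g\<close> is multiplied by the \<open>m\<close>-th roots of unity, and
contribute nothing.\<close>

lemma SL_average_exists:
  fixes w :: "'m::finite cpoly"
  assumes "w \<in> forms D"
  obtains N J where
    "\<And>d. poly_on D (J d)"
    "\<And>d h v. v \<in> forms D \<Longrightarrow> h \<in> SL \<Longrightarrow> J d (act h v) = J d v"
    "\<And>d t v. v \<in> forms D \<Longrightarrow> J d (Const t * v) = t ^ d * J d v"
    "\<And>c \<kappa>. (\<And>s. s \<in> SL \<Longrightarrow> polyfun p (Const c * act s w) = \<kappa>) \<Longrightarrow> (\<Sum>d\<le>N. c ^ d * J d w) = \<kappa>"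
proof -
  let ?m = "CARD('m)"
  obtain N where N: "\<And>v. polyfun p v = (\<Sum>d\<le>N. polyfun (homogeneous_part d p) v)"
    using polyfun_eq_sum_homogeneous_part by blast
  define E where "E = D * N"
  define good where "good d \<longleftrightarrow> d \<le> N \<and> ?m dvd D * d" for d
  define e where "e d = D * d div ?m" for d
  define F where "F d v g = polyfun (homogeneous_part d p) (act g v) * det g ^ (E - e d)"
    for d and v :: "'m cpoly" and g :: "complex^'m^'m"
  define \<Delta> where "\<Delta> = omega E (\<lambda>g :: complex^'m^'m. det g ^ E)"
  define J where "J d v = (if good d then omega E (F d v) / \<Delta> else 0)" for d v
  have "\<Delta> \<noteq> 0" by (simp add: \<Delta>_def omega_det_power_nonzero)
  have m: "?m > 0" by simp
  have e: "D * d = ?m * e d" "e d \<le> E" if "good d" for d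
  proof -
    show *: "D * d = ?m * e d" using that by (simp add: good_def e_def)
    have "e d \<le> ?m * e d" by simp
    also have "\<dots> \<le> E" using that unfolding *[symmetric] E_def good_def by simp
    finally show "e d \<le> E" .
  qed
  have entry_form_F: "entry_form (E * ?m) (F d v)" if "good d" "v \<in> forms D" for d and v :: "'m cpoly"
  proof -
    have "entry_form (D * d + (E - e d) * ?m) (F d v)"
      unfolding F_def by (intro entry_form_mult entry_form_power entry_form_det entry_form_polyfun_act that)
    moreover have "D * d + (E - e d) * ?m = E * ?m"
      using e[OF that(1)] by (simp add: algebra_simps flip: add_mult_distrib)
    ultimately show ?thesis by simp
  qed
  show ?thesis
  proof (rule that[of J N])
    fix d
    have "poly_on D (\<lambda>v. F d v g)" for g
      unfolding F_def mult.commute[of "polyfun _ _"] by (intro poly_on_cmult poly_on_polyfun_act)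
    then have "poly_on D (\<lambda>v. (1 / \<Delta>) * omega E (F d v))"
      by (intro poly_on_cmult poly_on_omega)
    then show "poly_on D (J d)"
      using poly_on_0 by (cases "good d") (simp_all add: J_def[abs_def])
  next
    fix d and h :: "complex^'m^'m" and v :: "'m cpoly" assume v: "v \<in> forms D" and h: "h \<in> SL"
    have "F d (act h v) = (\<lambda>g. F d v (g ** h))"
      using h by (simp add: F_def fun_eq_iff act_act det_mul SL_def)
    then show "J d (act h v) = J d v"
      using omega_translate[OF entry_form_F[OF _ v], of d h] h by (simp add: J_def SL_def)
  next
    fix d t and v :: "'m cpoly" assume v: "v \<in> forms D"
    have "F d (Const t * v) = (\<lambda>g. t ^ d * F d v g)"
      by (simp add: F_def fun_eq_iff act_Const_mult polyfun_homogeneous_part_scale)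
    then show "J d (Const t * v) = t ^ d * J d v"
      by (simp add: J_def omega_cmult)
  next
    fix c \<kappa> assume \<kappa>: "\<And>s :: complex^'m^'m. s \<in> SL \<Longrightarrow> polyfun p (Const c * act s w) = \<kappa>"
    \<comment> \<open>For invertible \<open>g\<close>, divide by all scalars \<open>t z\<close> with \<open>(t z)\<^sup>m = det g\<close> to get into \<open>SL\<close>, and sum over \<open>z\<close>.\<close>
    have inv: "(\<Sum>d | good d. c ^ d * F d w g) = \<kappa> * det g ^ E" if "det g \<noteq> 0" for g :: "complex^'m^'m"
    proof -
      obtain t where t: "t ^ ?m = det g" using ex_nth_root[OF m] by blast
      then have "t \<noteq> 0" using that by (auto simp: power_0_left)
      let ?a = "\<lambda>d. polyfun (homogeneous_part d p) (act g w)"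
      have "\<kappa> = (\<Sum>d\<le>N. c ^ d * inverse t ^ (D * d) * ?a d * inverse z ^ (D * d))" if z: "z ^ ?m = 1" for z
      proof -
        have "mat (inverse (t * z)) ** g \<in> SL"
          using t z \<open>det g \<noteq> 0\<close> by (simp add: SL_def det_mat_mult power_mult_distrib power_inverse)
        then have "\<kappa> = polyfun p (Const c * act (mat (inverse (t * z)) ** g) w)"
          using \<kappa> by simp
        also have "act (mat (inverse (t * z)) ** g) w = Const (inverse (t * z) ^ D) * act g w"
          using act_mat[OF act_forms[OF assms, of g], of "inverse (t * z)"] by (simp add: act_act)
        also have "polyfun p (Const c * (Const (inverse (t * z) ^ D) * act g w))
           = (\<Sum>d\<le>N. c ^ d * ((inverse (t * z) ^ D) ^ d * ?a d))"
          by (simp only: N polyfun_homogeneous_part_scale)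
        finally show ?thesis
          by (simp add: power_mult_distrib mult_ac flip: power_mult)
      qed
      then have "(\<Sum>z | z ^ ?m = (1::complex). \<kappa>) =
         (\<Sum>z | z ^ ?m = (1::complex). \<Sum>d\<le>N. c ^ d * inverse t ^ (D * d) * ?a d * inverse z ^ (D * d))"
        by (intro sum.cong refl) auto
      also have "\<dots> = (\<Sum>d\<le>N. \<Sum>z | z ^ ?m = (1::complex). c ^ d * inverse t ^ (D * d) * ?a d * inverse z ^ (D * d))"
        by (rule sum.swap)
      also have "\<dots> = (\<Sum>d\<le>N. c ^ d * inverse t ^ (D * d) * ?a d * (if ?m dvd D * d then of_nat ?m else 0))"
        by (simp only: sum_distrib_left[symmetric] sum_roots_unity_inverse_power[OF m])
      also have "\<dots> = (\<Sum>d | good d. c ^ d * inverse t ^ (D * d) * ?a d * of_nat ?m)"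
        by (intro sum.mono_neutral_cong_right) (auto simp: good_def)
      also have "\<dots> = of_nat ?m * (\<Sum>d | good d. c ^ d * inverse t ^ (D * d) * ?a d)"
        by (simp add: sum_distrib_left mult_ac)
      finally have "\<kappa> = (\<Sum>d | good d. c ^ d * inverse t ^ (D * d) * ?a d)"
        by (simp add: card_roots_unity_eq)
      then have "\<kappa> * det g ^ E = (\<Sum>d | good d. c ^ d * inverse t ^ (D * d) * ?a d * det g ^ E)"
        by (simp add: sum_distrib_right)
      also have "\<dots> = (\<Sum>d | good d. c ^ d * F d w g)"
      proof (intro sum.cong refl)
        fix d assume "d \<in> {d. good d}"
        then have d: "D * d = ?m * e d" "e d \<le> E" using e by auto
        have "det g ^ E = det g ^ e d * det g ^ (E - e d)" using d by (simp flip: power_add)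
        also have "det g ^ e d = t ^ (D * d)" unfolding d by (simp add: power_mult t)
        finally show "c ^ d * inverse t ^ (D * d) * ?a d * det g ^ E = c ^ d * F d w g"
          using \<open>t \<noteq> 0\<close> by (simp add: F_def power_inverse)
      qed
      finally show ?thesis ..
    qed
    have fin: "finite {d. good d}" by (rule finite_subset[of _ "{..N}"]) (auto simp: good_def)
    \<comment> \<open>The functional \<open>omega\<close> also evaluates at singular matrices, so the identity is needed there too.\<close>
    have "(\<Sum>d | good d. c ^ d * F d w g) = \<kappa> * det g ^ E" for g
    proof (rule continuous_eq_if_eq_on_invertible[OF _ _ inv])
      show "continuous_on UNIV (\<lambda>g. \<Sum>d | good d. c ^ d * F d w g)"
        using assms by (intro continuous_intros entry_form_continuous[OF entry_form_F]) auto
      show "continuous_on UNIV (\<lambda>g :: complex^'m^'m. \<kappa> * det g ^ E)"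
        by (intro continuous_intros entry_form_continuous[OF entry_form_det])
    qed
    then have "omega E (\<lambda>g. \<Sum>d | good d. c ^ d * F d w g) = \<kappa> * \<Delta>"
      by (simp add: \<Delta>_def omega_cmult)
    then have "(\<Sum>d | good d. c ^ d * omega E (F d w)) = \<kappa> * \<Delta>"
      by (simp add: omega_sum omega_cmult)
    then have "(\<Sum>d | good d. c ^ d * J d w) = \<kappa>"
      using \<open>\<Delta> \<noteq> 0\<close> by (simp add: J_def field_simps flip: sum_divide_distrib)
    moreover have "(\<Sum>d\<le>N. c ^ d * J d w) = (\<Sum>d | good d. c ^ d * J d w)"
      by (intro sum.mono_neutral_right) (auto simp: good_def J_def)
    ultimately show "(\<Sum>d\<le>N. c ^ d * J d w) = \<kappa>" by simp
  qed
qed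

section \<open>The weak Nullstellensatz over the complex numbers\<close>

definition poly_ideal :: "'x cpoly set \<Rightarrow> bool" where
  "poly_ideal I \<longleftrightarrow> 0 \<in> I \<and> (\<forall>p\<in>I. \<forall>q\<in>I. p + q \<in> I) \<and> (\<forall>p\<in>I. \<forall>r. r * p \<in> I)"

lemma poly_idealI:
  assumes "0 \<in> I" "\<And>p q. p \<in> I \<Longrightarrow> q \<in> I \<Longrightarrow> p + q \<in> I" "\<And>p r. p \<in> I \<Longrightarrow> r * p \<in> I"
  shows "poly_ideal I"
  using assms by (simp add: poly_ideal_def)

lemma
  assumes "poly_ideal I"
  shows poly_ideal_0: "0 \<in> I"
    and poly_ideal_add: "p \<in> I \<Longrightarrow> q \<in> I \<Longrightarrow> p + q \<in> I"
    and poly_ideal_mult: "p \<in> I \<Longrightarrow> r * p \<in> I"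
  using assms by (auto simp: poly_ideal_def)

lemma poly_ideal_diff: "poly_ideal I \<Longrightarrow> p \<in> I \<Longrightarrow> q \<in> I \<Longrightarrow> p - q \<in> I"
  using poly_ideal_add[of I p "-q"] poly_ideal_mult[of I q "-1"] by simp

lemma poly_ideal_sum: "poly_ideal I \<Longrightarrow> (\<And>k. k \<in> A \<Longrightarrow> p k \<in> I) \<Longrightarrow> (\<Sum>k\<in>A. p k) \<in> I"
  by (induction A rule: infinite_finite_induct) (auto intro: poly_ideal_0 poly_ideal_add)

lemma ex_maximal_poly_ideal:
  assumes "poly_ideal I" "1 \<notin> I"
  obtains M where "poly_ideal M" "1 \<notin> M" "I \<subseteq> M"
    "\<And>J. poly_ideal J \<Longrightarrow> M \<subseteq> J \<Longrightarrow> 1 \<notin> J \<Longrightarrow> J = M"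
proof -
  let ?S = "{J. poly_ideal J \<and> 1 \<notin> J \<and> I \<subseteq> J}"
  have "\<exists>M\<in>?S. \<forall>X\<in>?S. M \<subseteq> X \<longrightarrow> X = M"
  proof (rule subset_Zorn_nonempty)
    show "?S \<noteq> {}" using assms by auto
    fix C assume C: "C \<noteq> {}" "subset.chain ?S C"
    then have ideal: "\<And>X. X \<in> C \<Longrightarrow> poly_ideal X" by (auto simp: subset.chain_def)
    have "poly_ideal (\<Union>C)"
    proof (rule poly_idealI)
      show "0 \<in> \<Union>C" using C(1) ideal poly_ideal_0 by blast
      show "r * p \<in> \<Union>C" if "p \<in> \<Union>C" for p r
        using that ideal poly_ideal_mult by blast
      show "p + q \<in> \<Union>C" if pq: "p \<in> \<Union>C" "q \<in> \<Union>C" for p q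
      proof -
        obtain X Y where XY: "X \<in> C" "Y \<in> C" "p \<in> X" "q \<in> Y" using pq by blast
        then have "X \<subseteq> Y \<or> Y \<subseteq> X" using C unfolding subset_chain_def by blast
        then show ?thesis
        proof
          assume "X \<subseteq> Y"
          then have "p + q \<in> Y" using XY ideal poly_ideal_add[of Y p q] by blast
          then show ?thesis using XY by blast
        next
          assume "Y \<subseteq> X"
          then have "p + q \<in> X" using XY ideal poly_ideal_add[of X p q] by blast
          then show ?thesis using XY by blast
        qed
      qed
    qed
    then show "\<Union>C \<in> ?S" using C by (auto simp: subset.chain_def)
  qed
  then show ?thesis using that by (smt (verit) mem_Collect_eq order_trans)
qed

lemma countable_poly_mapping: "countable (UNIV :: ('x::countable \<Rightarrow>\<^sub>0 'b::{zero, countable}) set)"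
proof -
  let ?F = "\<lambda>\<mu>::'x \<Rightarrow>\<^sub>0 'b. (\<lambda>i. (i, Poly_Mapping.lookup \<mu> i)) ` Poly_Mapping.keys \<mu>"
  have "inj ?F"
  proof (rule injI, rule poly_mapping_eqI)
    fix \<mu> \<nu> :: "'x \<Rightarrow>\<^sub>0 'b" and i
    assume eq: "?F \<mu> = ?F \<nu>"
    then have "(i, n) \<in> ?F \<mu> \<longleftrightarrow> (i, n) \<in> ?F \<nu>" for n by simp
    then show "Poly_Mapping.lookup \<mu> i = Poly_Mapping.lookup \<nu> i"
      by (cases "Poly_Mapping.lookup \<mu> i = 0"; cases "Poly_Mapping.lookup \<nu> i = 0")
        (auto simp: in_keys_iff image_iff)
  qed
  moreover have "countable (range ?F)"
    by (rule countable_subset[OF _ countable_Collect_finite]) auto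
  ultimately show ?thesis using countable_image_inj_eq by blast
qed

instance poly_mapping :: (countable, "{zero, countable}") countable
  by intro_classes (use countable_poly_mapping in \<open>auto simp: countable_def\<close>)

text \<open>The value of a univariate polynomial at an element of the polynomial ring.\<close>

definition at_poly :: "'x cpoly \<Rightarrow> complex poly \<Rightarrow> 'x cpoly" where
  "at_poly x f = poly (map_poly Const f) x"

lemma at_poly_0 [simp]: "at_poly x 0 = 0"
  and at_poly_pCons [simp]: "at_poly x (pCons a f) = Const a + x * at_poly x f"
proof -
  show "at_poly x 0 = 0" by (simp add: at_poly_def)
  have "map_poly Const (pCons a f) = (pCons (Const a) (map_poly Const f) :: 'a cpoly poly)"
    by (rule poly_eqI) (simp add: coeff_map_poly coeff_pCons split: nat.split)
  then show "at_poly x (pCons a f) = Const a + x * at_poly x f"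
    by (simp add: at_poly_def)
qed

lemma at_poly_add [simp]: "at_poly x (f + g) = at_poly x f + at_poly x g"
proof -
  have "map_poly Const (f + g) = (map_poly Const f + map_poly Const g :: 'a cpoly poly)"
    by (rule poly_eqI) (simp add: coeff_map_poly Const_add)
  then show ?thesis by (simp add: at_poly_def)
qed

lemma at_poly_smult [simp]: "at_poly x (smult c f) = Const c * at_poly x f"
  by (induction f) (simp_all add: Const_mult algebra_simps)

lemma at_poly_mult [simp]: "at_poly x (f * g) = at_poly x f * at_poly x g"
  by (induction f) (simp_all add: algebra_simps)

lemma at_poly_1 [simp]: "at_poly x 1 = 1"
  by (simp add: one_pCons)

lemma at_poly_sum: "at_poly x (\<Sum>k\<in>A. f k) = (\<Sum>k\<in>A. at_poly x (f k))"
  by (induction A rule: infinite_finite_induct) simp_all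

lemma at_poly_prod: "at_poly x (\<Prod>k\<in>A. f k) = (\<Prod>k\<in>A. at_poly x (f k))"
  by (induction A rule: infinite_finite_induct) simp_all

text \<open>Over \<open>\<complex>\<close> the polynomial \<open>f\<close> splits into linear factors, and each of them becomes a unit modulo
\<open>M\<close> at \<open>x\<close>.\<close>

lemma univariate_mem_ideal:
  fixes M :: "'x cpoly set"
  assumes M: "poly_ideal M"
    and inv: "\<And>b. \<exists>q. q * (x - Const b) - 1 \<in> M"
    and "f \<noteq> 0" "at_poly x f \<in> M"
  shows "1 \<in> M"
  using assms(3,4)
proof (induction "degree f" arbitrary: f)
  case 0
  then obtain c where c: "f = [:c:]" "c \<noteq> 0" using degree_eq_zeroE by (metis pCons_0_0)
  then have "Const c \<in> M" using 0 by simp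
  then have "Const (inverse c) * Const c \<in> M" by (rule poly_ideal_mult[OF M])
  then show ?case using c by (simp flip: Const_mult)
next
  case (Suc n)
  then obtain b where "poly f b = 0"
    using fundamental_theorem_of_algebra[of f] constant_degree[of f] by auto
  then obtain g where g: "f = [:-b, 1:] * g" by (metis poly_eq_0_iff_dvd dvdE)
  have "g \<noteq> 0" using Suc.prems g by auto
  then have "degree f = Suc (degree g)" unfolding g by (subst degree_mult_eq) auto
  then have "n = degree g" using Suc by simp
  obtain q where q: "q * (x - Const b) - 1 \<in> M" using inv by blast
  have "Const (-b) = - (Const b :: 'x cpoly)" using Const_diff[of 0 b] by simp
  moreover have "at_poly x f = at_poly x [:-b, 1:] * at_poly x g" unfolding g at_poly_mult ..
  ultimately have "at_poly x f = (x - Const b) * at_poly x g" by simp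
  then have "q * ((x - Const b) * at_poly x g) \<in> M" using Suc.prems poly_ideal_mult[OF M] by metis
  moreover have "at_poly x g * (q * (x - Const b) - 1) \<in> M" using poly_ideal_mult[OF M q] .
  ultimately have "q * ((x - Const b) * at_poly x g) - at_poly x g * (q * (x - Const b) - 1) \<in> M"
    using poly_ideal_diff[OF M] by blast
  then have "at_poly x g \<in> M" by (simp add: algebra_simps)
  then show ?case using Suc \<open>n = degree g\<close> \<open>g \<noteq> 0\<close> by blast
qed

lemma infinite_linear_relation:
  fixes q :: "complex \<Rightarrow> 'x cpoly"
  assumes "infinite T" "finite B" "\<And>a. a \<in> T \<Longrightarrow> Poly_Mapping.keys (q a) \<subseteq> B" "inj_on q T"
  obtains U c where "finite U" "U \<subseteq> T" "(\<Sum>a\<in>U. Const (c a) * q a) = 0" "\<exists>a\<in>U. c a \<noteq> 0"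
proof -
  interpret V: vector_space "\<lambda>c p. Const c * (p :: 'x cpoly)"
    by unfold_locales (simp_all add: algebra_simps Const_add Const_mult)
  let ?B = "(\<lambda>\<mu>. Poly_Mapping.single \<mu> 1) ` B"
  have "q ` T \<subseteq> V.span ?B"
  proof
    fix p assume "p \<in> q ` T"
    then have "Poly_Mapping.keys p \<subseteq> B" using assms(3) by auto
    have "p = (\<Sum>\<mu>\<in>Poly_Mapping.keys p. Const (Poly_Mapping.lookup p \<mu>) * Poly_Mapping.single \<mu> 1)"
      using cpoly_eq_sum_single[of p] by (simp add: Const_mult_single)
    also have "\<dots> \<in> V.span ?B"
      using \<open>Poly_Mapping.keys p \<subseteq> B\<close> by (intro V.span_sum V.span_scale V.span_base) auto
    finally show "p \<in> V.span ?B" .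
  qed
  moreover have "infinite (q ` T)" using assms finite_imageD by blast
  ultimately have "V.dependent (q ` T)"
    using V.independent_span_bound[of ?B "q ` T"] assms(2) by auto
  then obtain W c where W: "finite W" "W \<subseteq> q ` T" "(\<Sum>v\<in>W. Const (c v) * v) = 0" "\<exists>v\<in>W. c v \<noteq> 0"
    unfolding V.dependent_explicit by blast
  then obtain U where U: "U \<subseteq> T" "finite U" "W = q ` U"
    by (meson finite_subset_image)
  then have "inj_on q U" using assms(4) inj_on_subset by blast
  show ?thesis
    by (rule that[of U "c \<circ> q"]) (use U W \<open>inj_on q U\<close> in \<open>auto simp: sum.reindex\<close>)
qed

text \<open>Otherwise, by maximality, every \<open>x - b\<close> has an inverse \<open>q b\<close> modulo \<open>M\<close>. The \<open>q b\<close> are pairwise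
distinct, hence uncountable in number, while there are only countably many finite sets of monomials.
So infinitely many of them lie in a finite-dimensional space and satisfy a linear relation. After
multiplication by the product of the \<open>x - b\<close> involved, it says that a nonzero univariate polynomial
in \<open>x\<close> lies in \<open>M\<close>, which is impossible.\<close>

lemma maximal_ideal_contains_Var_minus_Const:
  fixes M :: "('x::countable) cpoly set"
  assumes M: "poly_ideal M" "1 \<notin> M"
    and max: "\<And>J. poly_ideal J \<Longrightarrow> M \<subseteq> J \<Longrightarrow> 1 \<notin> J \<Longrightarrow> J = M"
  shows "\<exists>b. x - Const b \<in> M"
proof (rule ccontr)
  assume no: "\<nexists>b. x - Const b \<in> M"
  have "\<exists>q. q * (x - Const b) - 1 \<in> M" for b
  proof -
    let ?J = "{p + r * (x - Const b) | p r. p \<in> M}"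
    have "poly_ideal ?J"
    proof (rule poly_idealI)
      have "0 = 0 + 0 * (x - Const b)" by simp
      then show "0 \<in> ?J" using poly_ideal_0[OF M(1)] by blast
      fix p q r :: "'x cpoly"
      assume "p \<in> ?J"
      then obtain p1 r1 where p: "p = p1 + r1 * (x - Const b)" "p1 \<in> M" by auto
      have "r * p = r * p1 + (r * r1) * (x - Const b)" by (simp add: p(1) algebra_simps)
      then show "r * p \<in> ?J" using poly_ideal_mult[OF M(1) p(2)] by blast
      assume "q \<in> ?J"
      then obtain p2 r2 where q: "q = p2 + r2 * (x - Const b)" "p2 \<in> M" by auto
      have "p + q = (p1 + p2) + (r1 + r2) * (x - Const b)" by (simp add: p(1) q(1) algebra_simps)
      then show "p + q \<in> ?J" using poly_ideal_add[OF M(1) p(2) q(2)] by blast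
    qed
    moreover have "M \<subseteq> ?J"
    proof
      fix p assume "p \<in> M"
      moreover have "p = p + 0 * (x - Const b)" by simp
      ultimately show "p \<in> ?J" by blast
    qed
    moreover have "x - Const b \<in> ?J"
    proof -
      have "x - Const b = 0 + 1 * (x - Const b)" by simp
      then show ?thesis using poly_ideal_0[OF M(1)] by blast
    qed
    ultimately have "1 \<in> ?J" using max no by blast
    then obtain p r where pr: "1 = p + r * (x - Const b)" "p \<in> M" by auto
    have "r * (x - Const b) - 1 = (-1) * p" by (subst pr(1)) simp
    then show ?thesis using poly_ideal_mult[OF M(1) pr(2), of "-1"] by metis
  qed
  then obtain q where q: "\<And>b. q b * (x - Const b) - 1 \<in> M" by metis
  have "inj q"
  proof (rule injI, rule ccontr)
    fix a b assume ab: "q a = q b" "a \<noteq> b"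
    have "(q a * (x - Const a) - 1) - (q b * (x - Const b) - 1) \<in> M"
      using poly_ideal_diff[OF M(1) q q] .
    then have "q a * Const (b - a) \<in> M" using ab by (simp add: algebra_simps Const_diff)
    then have "(Const (inverse (b - a)) * (x - Const a)) * (q a * Const (b - a)) \<in> M"
      by (rule poly_ideal_mult[OF M(1)])
    also have "(Const (inverse (b - a)) * (x - Const a)) * (q a * Const (b - a))
        = Const (inverse (b - a) * (b - a)) * (q a * (x - Const a))"
      unfolding Const_mult by (simp only: mult_ac)
    also have "\<dots> = q a * (x - Const a)" using ab by simp
    finally have "q a * (x - Const a) - (q a * (x - Const a) - 1) \<in> M"
      using poly_ideal_diff[OF M(1) _ q] by blast
    then show False using M by simp
  qed
  have "\<exists>B. uncountable {a. Poly_Mapping.keys (q a) = B}"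
  proof (rule ccontr)
    assume "\<nexists>B. uncountable {a. Poly_Mapping.keys (q a) = B}"
    moreover have "countable (range (\<lambda>a. Poly_Mapping.keys (q a)))"
      by (rule countable_subset[OF _ countable_Fpow[OF countableI_type]]) (auto simp: Fpow_def)
    ultimately have "countable (\<Union>B\<in>range (\<lambda>a. Poly_Mapping.keys (q a)). {a. Poly_Mapping.keys (q a) = B})"
      by (intro countable_UN) auto
    also have "(\<Union>B\<in>range (\<lambda>a. Poly_Mapping.keys (q a)). {a. Poly_Mapping.keys (q a) = B}) = UNIV" by auto
    finally show False using uncountable_UNIV_complex by simp
  qed
  then obtain B where B: "uncountable {a. Poly_Mapping.keys (q a) = B}" by blast
  then have "{a. Poly_Mapping.keys (q a) = B} \<noteq> {}" by (metis countable_empty)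
  then obtain a0 where "B = Poly_Mapping.keys (q a0)" by blast
  then have "finite B" by simp
  obtain U c where U: "finite U" "(\<Sum>a\<in>U. Const (c a) * q a) = 0" "\<exists>a\<in>U. c a \<noteq> 0"
    by (rule infinite_linear_relation[of "{a. Poly_Mapping.keys (q a) = B}" B q])
      (use B \<open>finite B\<close> \<open>inj q\<close> in \<open>auto intro: countable_finite inj_on_subset\<close>)
  define f where "f = (\<Sum>a\<in>U. smult (c a) (\<Prod>l\<in>U - {a}. [:-l, 1:]))"
  have lin: "at_poly x [:-l, 1:] = x - Const l" for l
    using Const_diff[of 0 l] by simp
  let ?P = "\<Prod>l\<in>U. x - Const l"
  have "?P * (\<Sum>a\<in>U. Const (c a) * q a) - at_poly x f = (\<Sum>a\<in>U. Const (c a) * (\<Prod>l\<in>U - {a}. x - Const l) * (q a * (x - Const a) - 1))"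
  proof -
    have "?P * (Const (c a) * q a) = Const (c a) * (\<Prod>l\<in>U - {a}. x - Const l) * (q a * (x - Const a))" if "a \<in> U" for a
      using prod.remove[OF U(1) that, of "\<lambda>l. x - Const l"] by (simp add: mult_ac)
    then have "(\<Sum>a\<in>U. Const (c a) * (\<Prod>l\<in>U - {a}. x - Const l) * (q a * (x - Const a) - 1))
        = (\<Sum>a\<in>U. ?P * (Const (c a) * q a) - Const (c a) * (\<Prod>l\<in>U - {a}. x - Const l))"
      by (intro sum.cong refl) (simp add: right_diff_distrib)
    then show ?thesis
      by (simp only: f_def at_poly_sum sum_distrib_left sum_subtractf at_poly_smult at_poly_prod lin)
  qed
  also have "\<dots> \<in> M" by (intro poly_ideal_sum poly_ideal_mult M q)
  finally have "0 - at_poly x f \<in> M" using U(2) by simp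
  then have "(-1) * (0 - at_poly x f) \<in> M" by (rule poly_ideal_mult[OF M(1)])
  then have "at_poly x f \<in> M" by simp
  moreover have "f \<noteq> 0"
  proof -
    obtain a where a: "a \<in> U" "c a \<noteq> 0" using U by blast
    have "poly f a = (\<Sum>b\<in>U. if b = a then c a * (\<Prod>l\<in>U - {a}. a - l) else 0)"
      unfolding f_def poly_sum using U(1) a by (intro sum.cong) (auto simp: poly_prod)
    also have "\<dots> \<noteq> 0" using a U(1) by simp
    finally show ?thesis by auto
  qed
  ultimately show False using univariate_mem_ideal[OF M(1), of x f] q M(2) by blast
qed

text \<open>Modulo a maximal ideal each variable is congruent to a constant, and these constants are the
coordinates of a common zero. Countably many variables are allowed because the coordinates of a form
are indexed by the monomials of all degrees.\<close>

theorem weak_Nullstellensatz: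
  fixes I :: "('x::countable) cpoly set"
  assumes "poly_ideal I" "1 \<notin> I"
  shows "\<exists>a. \<forall>p\<in>I. peval a p = 0"
proof -
  obtain M where M: "poly_ideal M" "1 \<notin> M" "I \<subseteq> M"
    and max: "\<And>J. poly_ideal J \<Longrightarrow> M \<subseteq> J \<Longrightarrow> 1 \<notin> J \<Longrightarrow> J = M"
    using ex_maximal_poly_ideal[OF assms] by metis
  have "\<forall>i. \<exists>b. Var i - Const b \<in> M"
    using maximal_ideal_contains_Var_minus_Const[OF M(1,2) max] by auto
  then obtain a where a: "\<And>i. Var i - Const (a i) \<in> M"
    by metis
  \<comment> \<open>\<open>R\<close> is a subring that contains the constants and the variables, hence the whole ring.\<close>
  define R where "R = {p. p - Const (peval a p) \<in> M}"
  have R_mult: "p * q \<in> R" if "p \<in> R" "q \<in> R" for p q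
  proof -
    have "q * (p - Const (peval a p)) + Const (peval a p) * (q - Const (peval a q)) \<in> M"
      using that by (intro poly_ideal_add poly_ideal_mult M) (auto simp: R_def)
    then show ?thesis by (simp add: R_def algebra_simps Const_mult)
  qed
  have R_add: "p + q \<in> R" if "p \<in> R" "q \<in> R" for p q
  proof -
    have "(p - Const (peval a p)) + (q - Const (peval a q)) \<in> M"
      using that by (intro poly_ideal_add M) (auto simp: R_def)
    then show ?thesis by (simp add: R_def algebra_simps Const_add)
  qed
  have R_Const: "Const c \<in> R" for c
    using poly_ideal_0[OF M(1)] by (simp add: R_def)
  have R_Var: "Var i \<in> R" for i
    using a by (simp add: R_def)
  have R_power: "p ^ n \<in> R" if "p \<in> R" for p n
    using that R_mult R_Const[of 1] by (induction n) auto
  have R_prod: "(\<Prod>k\<in>A. f k) \<in> R" if "\<And>k. k \<in> A \<Longrightarrow> f k \<in> R" for A :: "'x set" and f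
    using that R_mult R_Const[of 1] by (induction A rule: infinite_finite_induct) auto
  have R_sum: "(\<Sum>k\<in>A. f k) \<in> R" if "\<And>k. k \<in> A \<Longrightarrow> f k \<in> R" for A :: "('x \<Rightarrow>\<^sub>0 nat) set" and f
    using that R_add R_Const[of 0] by (induction A rule: infinite_finite_induct) auto
  have "psubst Var p \<in> R" for p
    unfolding psubst_def by (intro R_sum R_mult R_Const R_prod R_power R_Var)
  then have R: "p \<in> R" for p by (simp add: psubst_Var_id)
  have "peval a p = 0" if "p \<in> I" for p
  proof (rule ccontr)
    assume nz: "peval a p \<noteq> 0"
    have "p - (p - Const (peval a p)) \<in> M"
    proof (rule poly_ideal_diff[OF M(1)])
      show "p \<in> M" using that M by blast
      show "p - Const (peval a p) \<in> M" using R[of p] by (simp add: R_def)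
    qed
    then have "Const (peval a p) \<in> M" by simp
    then have "Const (inverse (peval a p)) * Const (peval a p) \<in> M"
      by (intro poly_ideal_mult M(1)) 
    then show False using nz M by (simp flip: Const_mult)
  qed
  then show ?thesis by blast
qed

section \<open>Separation of closed sets of forms\<close>

text \<open>If the ideals of \<open>Z1\<close> and \<open>Z2\<close> together did not generate \<open>1\<close>, they would have a common zero. It
is the coefficient function of a form of degree \<open>D\<close>, because the variables that belong to other
degrees vanish on \<open>Z1\<close>; so this form would lie in both sets.\<close>

lemma disjoint_zariski_closed_separated:
  fixes Z1 Z2 :: "'m::finite cpoly set"
  assumes "zariski_closed D Z1" "zariski_closed D Z2" "Z1 \<inter> Z2 = {}"
  shows "\<exists>r. (\<forall>v\<in>Z1. polyfun r v = 1) \<and> (\<forall>v\<in>Z2. polyfun r v = 0)"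
proof -
  obtain P1 P2 where P1: "Z1 = {v \<in> forms D. \<forall>p\<in>P1. polyfun p v = 0}"
    and P2: "Z2 = {v \<in> forms D. \<forall>p\<in>P2. polyfun p v = 0}"
    using assms by (auto simp: zariski_closed_def)
  let ?V = "\<lambda>Z p. \<forall>v\<in>Z. polyfun p v = 0"
  let ?I = "{p + q | p q. ?V Z1 p \<and> ?V Z2 q}"
  have mem: "p + q \<in> ?I" if "?V Z1 p" "?V Z2 q" for p q
    using that by blast
  have left: "p \<in> ?I" if "?V Z1 p" for p
    using mem[OF that, of 0] by (simp add: polyfun_def)
  have right: "q \<in> ?I" if "?V Z2 q" for q
    using mem[OF _ that, of 0] by (simp add: polyfun_def)
  have ideal: "poly_ideal ?I"
  proof (rule poly_idealI)
    show "0 \<in> ?I" by (rule left) (simp add: polyfun_def)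
    fix p q r assume "p \<in> ?I"
    then obtain p1 p2 where p: "p = p1 + p2" "?V Z1 p1" "?V Z2 p2" by blast
    show "r * p \<in> ?I"
      unfolding p(1) distrib_left using p(2,3) by (intro mem) (simp_all add: polyfun_def)
    assume "q \<in> ?I"
    then obtain q1 q2 where q: "q = q1 + q2" "?V Z1 q1" "?V Z2 q2" by blast
    have "p + q = (p1 + q1) + (p2 + q2)" by (simp add: p(1) q(1) add_ac)
    also have "\<dots> \<in> ?I"
      using p(2,3) q(2,3) by (intro mem) (simp_all add: polyfun_def)
    finally show "p + q \<in> ?I" .
  qed
  have "1 \<in> ?I"
  proof (rule ccontr)
    assume "1 \<notin> ?I"
    from weak_Nullstellensatz[OF ideal this]
    obtain a where "\<forall>p\<in>?I. peval a p = 0" by (rule exE)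
    then have a: "peval a p = 0" if "p \<in> ?I" for p
      using that by (rule bspec)
    have a0: "a \<mu> = 0" if "\<mu> \<notin> monomials D" for \<mu>
    proof -
      have "?V Z1 (Var \<mu>)" using that by (auto simp: P1 forms_iff polyfun_def in_keys_iff)
      from a[OF left[OF this]] have "peval a (Var \<mu>) = 0" .
      then show ?thesis by simp
    qed
    define v where "v = Abs_poly_mapping a"
    have "finite {\<mu>. a \<mu> \<noteq> 0}" by (rule finite_subset[of _ "monomials D"]) (use a0 in auto)
    then have v: "Poly_Mapping.lookup v = a" by (simp add: v_def)
    then have "v \<in> forms D" using a0 by (auto simp: forms_iff in_keys_iff)
    moreover have "polyfun p v = 0" if "p \<in> P1" for p
    proof -
      have "?V Z1 p" using that by (simp add: P1)
      from a[OF left[OF this]] show ?thesis by (simp add: polyfun_def v)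
    qed
    moreover have "polyfun p v = 0" if "p \<in> P2" for p
    proof -
      have "?V Z2 p" using that by (simp add: P2)
      from a[OF right[OF this]] show ?thesis by (simp add: polyfun_def v)
    qed
    ultimately have "v \<in> Z1 \<inter> Z2" by (simp add: P1 P2)
    then show False using assms by simp
  qed
  then obtain p q where pq: "1 = p + q" "?V Z1 p" "?V Z2 q" by blast
  have "polyfun q v = 1" if "v \<in> Z1" for v
  proof -
    have "polyfun (p + q) v = 1" unfolding pq(1)[symmetric] by (simp add: polyfun_def)
    moreover have "polyfun p v = 0" using that pq(2) by blast
    ultimately show ?thesis by (simp add: polyfun_def)
  qed
  then show ?thesis using pq(3) by blast
qed

text \<open>For \<open>c \<noteq> 0\<close> the equations are transported by the inverse scaling; for \<open>c = 0\<close> the image is \<open>{0}\<close>,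
since \<open>Z\<close> is not empty.\<close>

lemma zariski_closed_scale:
  fixes Z :: "'m::finite cpoly set"
  assumes Z: "zariski_closed D Z" "Z \<noteq> {}"
  shows "zariski_closed D ((\<lambda>v. Const c * v) ` Z)"
proof (cases "c = 0")
  case True
  then have "(\<lambda>v. Const c * v) ` Z = {0}" using Z by auto
  also have "{0 :: 'm cpoly} = {v \<in> forms D. \<forall>p\<in>range Var. polyfun p v = 0}"
  proof (rule set_eqI, rule iffI)
    fix v :: "'m cpoly" assume "v \<in> {v \<in> forms D. \<forall>p\<in>range Var. polyfun p v = 0}"
    then have "Poly_Mapping.lookup v \<mu> = 0" for \<mu> by (simp add: polyfun_def)
    then show "v \<in> {0}" by (simp add: poly_mapping_eqI)
  qed (auto simp: polyfun_def)
  finally show ?thesis unfolding zariski_closed_def by blast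
next
  case False
  then have inv: "Const c * (Const (inverse c) * v) = v" "Const (inverse c) * (Const c * v) = v" for v :: "'m cpoly"
    by (simp_all add: mult.assoc[symmetric] Const_mult[symmetric])
  obtain P where P: "Z = {v \<in> forms D. \<forall>p\<in>P. polyfun p v = 0}"
    using Z by (auto simp: zariski_closed_def)
  have "\<forall>p. \<exists>q. \<forall>v\<in>(forms D :: 'm cpoly set). polyfun p (Const (inverse c) * v) = polyfun q v"
    by (intro allI) (rule poly_on_polyfun_scale[unfolded poly_on_def])
  from choice[OF this] obtain q
    where "\<forall>p. \<forall>v\<in>(forms D :: 'm cpoly set). polyfun p (Const (inverse c) * v) = polyfun (q p) v" ..
  then have q: "polyfun p (Const (inverse c) * v) = polyfun (q p) v" if "v \<in> forms D" for p and v :: "'m cpoly"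
    using that by blast
  have "(\<lambda>v. Const c * v) ` Z = {v \<in> forms D. \<forall>p\<in>q ` P. polyfun p v = 0}"
  proof (intro equalityI subsetI)
    fix u assume "u \<in> (\<lambda>v. Const c * v) ` Z"
    then obtain v where "v \<in> Z" "u = Const c * v" by blast
    then show "u \<in> {v \<in> forms D. \<forall>p\<in>q ` P. polyfun p v = 0}"
      using q[of u] by (auto simp: P forms_Const_mult inv)
  next
    fix u assume u: "u \<in> {v \<in> forms D. \<forall>p\<in>q ` P. polyfun p v = 0}"
    then have "Const (inverse c) * u \<in> Z"
      using q[of u] by (auto simp: P forms_Const_mult)
    then have "Const c * (Const (inverse c) * u) \<in> (\<lambda>v. Const c * v) ` Z" by (rule imageI)
    then show "u \<in> (\<lambda>v. Const c * v) ` Z" by (simp only: inv)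
  qed
  then show ?thesis unfolding zariski_closed_def by blast
qed

section \<open>Invariants on the orbit closure\<close>

lemma orbit_closure_iff:
  assumes "w \<in> forms D"
  shows "v \<in> orbit_closure D w \<longleftrightarrow>
    v \<in> forms D \<and> (\<forall>p. (\<forall>g\<in>GL. polyfun p (act g w) = 0) \<longrightarrow> polyfun p v = 0)"
proof
  assume v: "v \<in> orbit_closure D w"
  let ?P = "{p. \<forall>g\<in>GL. polyfun p (act g w) = 0}"
  let ?Z = "{v \<in> forms D. \<forall>p\<in>?P. polyfun p v = 0}"
  have "zariski_closed D ?Z" unfolding zariski_closed_def by blast
  moreover have "orbit GL w \<subseteq> ?Z" using assms by (auto simp: orbit_def act_forms)
  ultimately have "v \<in> ?Z" using v by (auto simp: orbit_closure_def hull_def)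
  then show "v \<in> forms D \<and> (\<forall>p. (\<forall>g\<in>GL. polyfun p (act g w) = 0) \<longrightarrow> polyfun p v = 0)" by blast
next
  assume v: "v \<in> forms D \<and> (\<forall>p. (\<forall>g\<in>GL. polyfun p (act g w) = 0) \<longrightarrow> polyfun p v = 0)"
  have "v \<in> Z" if "zariski_closed D Z" "orbit GL w \<subseteq> Z" for Z
  proof -
    obtain P where P: "Z = {v \<in> forms D. \<forall>p\<in>P. polyfun p v = 0}"
      using \<open>zariski_closed D Z\<close> by (auto simp: zariski_closed_def)
    have "\<forall>g\<in>GL. polyfun p (act g w) = 0" if "p \<in> P" for p
      using that \<open>orbit GL w \<subseteq> Z\<close> by (auto simp: P orbit_def)
    then show ?thesis using v by (auto simp: P)
  qed
  then show "v \<in> orbit_closure D w" by (auto simp: orbit_closure_def hull_def)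
qed

lemma GL_iff: "g \<in> GL \<longleftrightarrow> det g \<noteq> 0"
  by (simp add: GL_def invertible_det_nz)

lemma orbit_subset_orbit_closure: "w \<in> forms D \<Longrightarrow> g \<in> GL \<Longrightarrow> act g w \<in> orbit_closure D w"
  by (simp add: orbit_closure_iff act_forms)

lemma mem_orbit_closure: "w \<in> forms D \<Longrightarrow> w \<in> orbit_closure D w"
  using orbit_subset_orbit_closure[of w D "mat 1"] by (simp add: GL_iff)

lemma orbit_closure_act:
  assumes w: "w \<in> forms D" and v: "v \<in> orbit_closure D w" and g: "g \<in> GL"
  shows "act g v \<in> orbit_closure D w"
proof -
  have vD: "v \<in> forms D" using v orbit_closure_iff[OF w] by blast
  have "polyfun p (act g v) = 0" if p: "\<forall>h\<in>GL. polyfun p (act h w) = 0" for p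
  proof -
    obtain q where q: "\<And>v. v \<in> forms D \<Longrightarrow> polyfun p (act g v) = polyfun q v"
      using poly_on_polyfun_act unfolding poly_on_def by blast
    have "polyfun q (act h w) = 0" if "h \<in> GL" for h
    proof -
      have "g ** h \<in> GL" using g that by (simp add: GL_iff det_mul)
      then show ?thesis using p q[OF act_forms[OF w], of h] by (simp add: act_act)
    qed
    then have "polyfun q v = 0" using v orbit_closure_iff[OF w] by blast
    then show ?thesis using q[OF vD] by simp
  qed
  then show ?thesis using vD by (simp add: orbit_closure_iff[OF w] act_forms)
qed

text \<open>A scalar \<open>t \<noteq> 0\<close> acts as a scalar matrix. For \<open>t = 0\<close>, a polynomial that vanishes on the orbit
vanishes at \<open>s v\<close> for all \<open>s \<noteq> 0\<close>, hence by continuity also for \<open>s = 0\<close>.\<close>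

lemma orbit_closure_scale:
  fixes w :: "'m::finite cpoly"
  assumes D: "D \<ge> 1" and w: "w \<in> forms D" and v: "v \<in> orbit_closure D w"
  shows "Const t * v \<in> orbit_closure D w"
proof -
  have vD: "v \<in> forms D" using v orbit_closure_iff[OF w] by blast
  have nz: "Const t * v \<in> orbit_closure D w" if "t \<noteq> 0" for t
  proof -
    obtain u where u: "u ^ D = t" using ex_nth_root[of D t] D by auto
    then have "u \<noteq> 0" using that D by (auto simp: power_0_left)
    then have "mat u \<in> (GL :: (complex^'m^'m) set)"
      using det_mat_mult[of u "mat 1 :: complex^'m^'m"] by (simp add: GL_iff)
    then have "act (mat u) v \<in> orbit_closure D w" by (rule orbit_closure_act[OF w v])
    then show ?thesis by (simp only: act_mat[OF vD] u)
  qed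
  show ?thesis
  proof (cases "t = 0")
    case True
    have "polyfun p 0 = 0" if p: "\<forall>h\<in>GL. polyfun p (act h w) = 0" for p
    proof -
      obtain N where N: "\<And>v. polyfun p v = (\<Sum>d\<le>N. polyfun (homogeneous_part d p) v)"
        using polyfun_eq_sum_homogeneous_part by blast
      define f where "f s = (\<Sum>d\<le>N. s ^ d * polyfun (homogeneous_part d p) v)" for s
      have f: "polyfun p (Const s * v) = f s" for s
        by (simp add: N polyfun_homogeneous_part_scale f_def)
      have "continuous_on (closure (- {0})) f" unfolding f_def by (intro continuous_intros)
      moreover have "f s = 0" if "s \<in> - {0}" for s
        using nz[of s] that p orbit_closure_iff[OF w] f by auto
      moreover have "0 \<in> closure (- {0::complex})"
        unfolding closure_complement by (simp add: empty_interior_finite)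
      ultimately have "f 0 = 0" by (rule continuous_constant_on_closure)
      then show ?thesis using f[of 0] by simp
    qed
    then show ?thesis using True by (simp add: orbit_closure_iff[OF w])
  qed (rule nz)
qed

lemma zero_mem_SL_invariants: "(\<lambda>_. 0) \<in> SL_invariants X d"
proof -
  have "\<exists>p. \<forall>v\<in>X. (0::complex) = polyfun p v" by (rule exI[of _ 0]) (simp add: polyfun_def)
  then show ?thesis by (simp add: SL_invariants_def coord_ring_def)
qed

lemma SL_subset_GL: "SL \<subseteq> GL"
  by (auto simp: SL_def GL_iff)

lemma degree_monoidI:
  assumes D: "D \<ge> 1" and w: "w \<in> forms D"
    and f: "poly_on D f"
    and inv: "\<And>h v. v \<in> forms D \<Longrightarrow> h \<in> SL \<Longrightarrow> f (act h v) = f v"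
    and hom: "\<And>t v. v \<in> forms D \<Longrightarrow> f (Const t * v) = t ^ d * f v"
    and "f w \<noteq> 0"
  shows "d \<in> degree_monoid D w"
proof -
  let ?X = "orbit_closure D w"
  define F where "F v = (if v \<in> ?X then f v else 0)" for v
  have X: "v \<in> forms D" if "v \<in> ?X" for v using that orbit_closure_iff[OF w] by blast
  obtain q where q: "\<forall>v\<in>forms D. f v = polyfun q v" using f unfolding poly_on_def ..
  have "\<forall>v\<in>?X. F v = polyfun q v" using q X by (simp add: F_def)
  then have "F \<in> coord_ring ?X"
    unfolding coord_ring_def by (auto simp: F_def)
  moreover have "F (act g v) = F v" if "g \<in> SL" "v \<in> ?X" for g v
    using that orbit_closure_act[OF w that(2)] SL_subset_GL inv X by (auto simp: F_def)
  moreover have "F (Const t * v) = t ^ d * F v" if "v \<in> ?X" for t v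
    using that orbit_closure_scale[OF D w that] hom X by (auto simp: F_def)
  ultimately have "F \<in> SL_invariants ?X d" by (simp add: SL_invariants_def)
  moreover have "F \<noteq> (\<lambda>_. 0)"
    using mem_orbit_closure[OF w] \<open>f w \<noteq> 0\<close> by (auto simp: F_def fun_eq_iff)
  ultimately have "SL_invariants ?X d \<noteq> {\<lambda>_. 0}" by (metis singletonD)
  then show ?thesis by (simp add: degree_monoid_def)
qed

lemma GL_eq_mat_mult_SL:
  fixes g :: "complex^'m^'m::finite"
  assumes "g \<in> GL"
  obtains t s where "t \<noteq> 0" "s \<in> SL" "g = mat t ** s"
proof -
  obtain t where t: "t ^ CARD('m) = det g" using ex_nth_root[of "CARD('m)"] by auto
  then have "t \<noteq> 0" using assms by (auto simp: GL_iff power_0_left)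
  have "mat (inverse t) ** g \<in> SL"
    using \<open>t \<noteq> 0\<close> t assms by (simp add: SL_def det_mat_mult power_inverse GL_iff)
  moreover have "mat t ** mat (inverse t) = (mat 1 :: complex^'m^'m)"
    using \<open>t \<noteq> 0\<close> by (simp add: vec_eq_iff matrix_matrix_mult_def mat_def if_distrib[of "\<lambda>x. x * _"] cong: if_cong)
  then have "g = mat t ** (mat (inverse t) ** g)" by (simp add: matrix_mul_assoc)
  ultimately show ?thesis using that \<open>t \<noteq> 0\<close> by blast
qed

text \<open>At \<open>g w\<close>, where \<open>g\<close> is the scalar \<open>t\<close> times an element of \<open>SL\<close>, an invariant of degree \<open>d\<close> is
\<open>t\<^sup>D\<^sup>d\<close> times its value at \<open>w\<close>. If that value is zero, then the invariant vanishes on the orbit, and so on its closure.\<close>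

lemma degree_monoidD:
  fixes w :: "'m::finite cpoly"
  assumes w: "w \<in> forms D" and d: "d \<in> degree_monoid D w"
  shows "\<exists>f\<in>SL_invariants (orbit_closure D w) d. f w \<noteq> 0"
proof -
  let ?X = "orbit_closure D w"
  obtain f where f: "f \<in> SL_invariants ?X d" "f \<noteq> (\<lambda>_. 0)"
  proof -
    have "SL_invariants ?X d \<noteq> {\<lambda>_. 0}" using d by (simp add: degree_monoid_def)
    then show ?thesis using that zero_mem_SL_invariants[of ?X d] by blast
  qed
  then obtain p where p: "\<And>v. v \<in> ?X \<Longrightarrow> f v = polyfun p v" and out: "\<And>v. v \<notin> ?X \<Longrightarrow> f v = 0"
    and inv: "\<And>g v. g \<in> SL \<Longrightarrow> v \<in> ?X \<Longrightarrow> f (act g v) = f v"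
    and hom: "\<And>t v. v \<in> ?X \<Longrightarrow> f (Const t * v) = t ^ d * f v"
    by (auto simp: SL_invariants_def coord_ring_def)
  have "f w \<noteq> 0"
  proof
    assume fw: "f w = 0"
    have "polyfun p (act g w) = 0" if g: "g \<in> GL" for g :: "complex^'m^'m"
    proof -
      obtain t s where ts: "t \<noteq> 0" "s \<in> SL" "g = mat t ** s" using GL_eq_mat_mult_SL[OF g] .
      have "s \<in> GL" using ts SL_subset_GL by blast
      have eq: "act g w = Const (t ^ D) * act s w"
        using ts act_mat[OF act_forms[OF w]] by (simp flip: act_act)
      have "polyfun p (act g w) = f (act g w)"
        using p orbit_subset_orbit_closure[OF w g] by simp
      also have "\<dots> = (t ^ D) ^ d * f w"
        unfolding eq using hom[OF orbit_subset_orbit_closure[OF w \<open>s \<in> GL\<close>]] inv[OF ts(2) mem_orbit_closure[OF w]] by simp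
      finally show ?thesis using fw by simp
    qed
    then have "f v = 0" for v
      using p out orbit_closure_iff[OF w, of v] by (cases "v \<in> ?X") auto
    then show False using f by auto
  qed
  then show ?thesis using f by blast
qed

lemma power_degree_eq_1:
  assumes w: "w \<in> forms D" and d: "d \<in> degree_monoid D w" and c: "Const c * w \<in> orbit SL w"
  shows "c ^ d = 1"
proof -
  obtain f where f: "f \<in> SL_invariants (orbit_closure D w) d" "f w \<noteq> 0"
    using degree_monoidD[OF w d] by blast
  obtain s where "s \<in> SL" "Const c * w = act s w" using c by (auto simp: orbit_def)
  moreover have "f (Const c * w) = c ^ d * f w" "f (act s w) = f w"
    using f mem_orbit_closure[OF w] \<open>s \<in> SL\<close> by (simp_all add: SL_invariants_def)
  ultimately have "c ^ d * f w = f w" by simp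
  then show ?thesis using f by simp
qed

lemma SL_mult: "g \<in> SL \<Longrightarrow> h \<in> SL \<Longrightarrow> g ** h \<in> SL"
  by (simp add: SL_def det_mul)

lemma SL_inverse:
  assumes "g \<in> SL" obtains h where "h \<in> SL" "h ** g = mat 1"
proof -
  have "invertible g" using assms SL_subset_GL by (auto simp: GL_def)
  then obtain h where h: "h ** g = mat 1" by (auto simp: invertible_def)
  then have "det h * det g = 1" by (metis det_mul det_I)
  then have "h \<in> SL" using assms by (simp add: SL_def)
  then show ?thesis using that h by blast
qed

text \<open>Averaging a polynomial that separates the orbit from its translate by \<open>c\<close> gives a polynomial
\<open>\<Sum>\<^sub>d J\<^sub>d(w) x\<^sup>d\<close> with the value \<open>1\<close> at \<open>x = 1\<close> and \<open>0\<close> at \<open>x = c\<close>, so one of its terms distinguishes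
\<open>c\<close> from \<open>1\<close>. The case \<open>c = 0\<close> is included; there it provides an invariant of positive degree.\<close>

lemma ex_degree_power_neq_1:
  fixes w :: "'m::finite cpoly"
  assumes D: "D \<ge> 1" and w: "w \<in> forms D" and ps: "polystable D w"
    and c: "Const c * w \<notin> orbit SL w"
  shows "\<exists>d\<in>degree_monoid D w. c ^ d \<noteq> 1"
proof -
  let ?Y = "orbit SL w"
  let ?cY = "(\<lambda>v. Const c * v) ` ?Y"
  have "?Y \<inter> ?cY = {}"
  proof (rule ccontr)
    assume "?Y \<inter> ?cY \<noteq> {}"
    then obtain s1 s2 where s: "s1 \<in> SL" "s2 \<in> SL" "act s1 w = Const c * act s2 w"
      by (auto simp: orbit_def)
    obtain h where h: "h \<in> SL" "h ** s2 = mat 1" using SL_inverse[OF s(2)] .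
    have "act (h ** s1) w = Const c * w"
      using arg_cong[OF s(3), of "act h"] h by (simp add: act_act act_Const_mult)
    then have "Const c * w \<in> ?Y" using SL_mult[OF h(1) s(1)] unfolding orbit_def by (metis imageI)
    then show False using c by blast
  qed
  moreover have closed: "zariski_closed D ?Y" using ps by (simp add: polystable_def)
  moreover have "mat 1 \<in> (SL :: (complex^'m^'m) set)" by (simp add: SL_def)
  then have "?Y \<noteq> {}" unfolding orbit_def by blast
  ultimately have "\<exists>r. (\<forall>v\<in>?Y. polyfun r v = 1) \<and> (\<forall>v\<in>?cY. polyfun r v = 0)"
    by (intro disjoint_zariski_closed_separated zariski_closed_scale)
  then obtain r where r: "\<forall>v\<in>?Y. polyfun r v = 1" "\<forall>v\<in>?cY. polyfun r v = 0"
    by (elim exE conjE)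
  obtain N J where J: "\<And>d. poly_on D (J d)"
    "\<And>d h v. v \<in> forms D \<Longrightarrow> h \<in> SL \<Longrightarrow> J d (act h v) = J d v"
    "\<And>d t v. v \<in> forms D \<Longrightarrow> J d (Const t * v) = t ^ d * J d v"
    and avg: "\<And>c \<kappa>. (\<And>s. s \<in> SL \<Longrightarrow> polyfun r (Const c * act s w) = \<kappa>) \<Longrightarrow> (\<Sum>d\<le>N. c ^ d * J d w) = \<kappa>"
  proof (rule SL_average_exists[OF w, of r], goal_cases)
    case (1 N J)
    show ?case by (rule 1(1)[OF 1(2-5)])
  qed
  have one: "(\<Sum>d\<le>N. 1 ^ d * J d w) = 1" using r(1) by (intro avg) (simp add: orbit_def)
  have zero: "(\<Sum>d\<le>N. c ^ d * J d w) = 0" using r(2) by (intro avg) (simp add: orbit_def)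
  have "\<exists>d. c ^ d * J d w \<noteq> 1 ^ d * J d w"
  proof (rule ccontr)
    assume "\<nexists>d. c ^ d * J d w \<noteq> 1 ^ d * J d w"
    then have "c ^ d * J d w = 1 ^ d * J d w" for d by simp
    then have "(\<Sum>d\<le>N. c ^ d * J d w) = (\<Sum>d\<le>N. 1 ^ d * J d w)" by (intro sum.cong refl)
    then show False using one zero by simp
  qed
  then obtain d where "c ^ d * J d w \<noteq> 1 ^ d * J d w" ..
  then have "J d w \<noteq> 0" "c ^ d \<noteq> 1" by auto
  moreover have "d \<in> degree_monoid D w"
    by (rule degree_monoidI[OF D w J \<open>J d w \<noteq> 0\<close>])
  ultimately show ?thesis by blast
qed

section \<open>The group of scalars that preserve the orbit\<close>

lemma power_Gcd_eq_1:
  fixes c :: complex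
  assumes "c \<noteq> 0" "\<And>d. d \<in> A \<Longrightarrow> c ^ d = 1"
  shows "c ^ Gcd A = 1"
proof -
  have "c powi s = 1" if "s \<in> group_closure (int ` A)" for s
    using that
  proof induction
    case (base s)
    then show ?case using assms by auto
  next
    case (diff s t)
    then show ?case using assms by (simp add: power_int_diff)
  qed
  from this[OF Gcd_in_group_closure] have "c powi int (Gcd A) = 1" by simp
  then show ?thesis by simp
qed

lemma scaling_group:
  fixes w :: "'m::finite cpoly"
  assumes D: "D \<ge> 1" and w: "w \<in> forms D" "w \<noteq> 0" and ps: "polystable D w"
  shows "Gcd (degree_monoid D w) > 0"
    and "Const c * w \<in> orbit SL w \<longleftrightarrow> c ^ Gcd (degree_monoid D w) = 1"
proof -
  let ?E = "degree_monoid D w"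
  \<comment> \<open>The scalar \<open>0\<close> does not preserve the orbit; this forces \<open>degree_monoid\<close> to contain a positive degree.\<close>
  have nz: "Const 0 * w \<notin> orbit SL w"
  proof
    assume "Const 0 * w \<in> orbit SL w"
    then obtain s :: "complex^'m^'m" where s: "s \<in> SL" "act s w = 0" by (auto simp: orbit_def)
    obtain h where h: "h \<in> SL" "h ** s = mat 1" using SL_inverse[OF s(1)] .
    have "w = act h (act s w)" using h by (simp add: act_act)
    then show False using s w by simp
  qed
  then obtain d0 where d0: "d0 \<in> ?E" "(0::complex) ^ d0 \<noteq> 1"
    using ex_degree_power_neq_1[OF D w(1) ps] by blast
  then have "d0 \<noteq> 0" by (cases d0) auto
  then show "Gcd ?E > 0" using d0 by (metis Gcd_0_iff gr0I singletonD subsetD)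
  show "Const c * w \<in> orbit SL w \<longleftrightarrow> c ^ Gcd ?E = 1"
  proof
    assume c: "Const c * w \<in> orbit SL w"
    then have "c \<noteq> 0" using nz by auto
    then show "c ^ Gcd ?E = 1" using power_degree_eq_1[OF w(1) _ c] by (rule power_Gcd_eq_1)
  next
    assume c: "c ^ Gcd ?E = 1"
    have "c ^ d = 1" if "d \<in> ?E" for d
      using Gcd_dvd[OF that] c by (auto elim!: dvdE simp: power_mult)
    then show "Const c * w \<in> orbit SL w" using ex_degree_power_neq_1[OF D w(1) ps] by blast
  qed
qed

text \<open>A matrix \<open>h\<close> with \<open>det h = t\<^sup>m\<close> is \<open>t\<close> times an element \<open>s\<close> of \<open>SL\<close>, and \<open>h\<close> fixes \<open>w\<close> if and only if \<open>s\<close>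
maps \<open>w\<close> to \<open>t\<^sup>-\<^sup>D w\<close>. So \<open>t\<^sup>m\<close> is a determinant of the stabilizer if and only if \<open>t\<^sup>D\<^sup>g = 1\<close>. Since
\<open>t\<^sup>m\<close> takes all values, this describes the determinants completely. The identity matrix shows that all
\<open>m\<close>-th roots of unity satisfy \<open>t\<^sup>D\<^sup>g = 1\<close>, hence the divisibility.\<close>

lemma det_stab:
  fixes w :: "'m::finite cpoly"
  assumes D: "D \<ge> 1" and w: "w \<in> forms D" "w \<noteq> 0" and ps: "polystable D w"
  defines "g \<equiv> Gcd (degree_monoid D w)"
  shows "CARD('m) dvd D * g" and "det ` stab w = {x. x ^ (D * g div CARD('m)) = 1}"
proof -
  let ?m = "CARD('m)"
  note scaling = scaling_group(2)[OF D w ps, folded g_def]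
  have root: "t ^ (D * g) = 1" if "h \<in> stab w" "t ^ ?m = det h" for h t
  proof -
    have h: "det h \<noteq> 0" "act h w = w" using that by (auto simp: stab_def GL_iff)
    then have "t \<noteq> 0" using that by (auto simp: power_0_left)
    have "mat (inverse t) ** h \<in> SL"
      using that h by (simp add: SL_def det_mat_mult power_inverse)
    moreover have "act (mat (inverse t) ** h) w = Const (inverse t ^ D) * w"
      using h act_mat[OF w(1), of "inverse t"] by (simp flip: act_act)
    ultimately have "Const (inverse t ^ D) * w \<in> orbit SL w" unfolding orbit_def by (metis imageI)
    then show ?thesis using scaling by (simp add: power_inverse flip: power_mult)
  qed
  have root': "t ^ ?m \<in> det ` stab w" if "t ^ (D * g) = 1" for t
  proof -
    have "D * g > 0" using D scaling_group(1)[OF D w ps] by (simp add: g_def)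
    then have "t \<noteq> 0" using that by (auto simp: power_0_left)
    have "Const (inverse t ^ D) * w \<in> orbit SL w"
      using scaling that by (simp add: power_inverse flip: power_mult)
    then obtain s :: "complex^'m^'m" where s: "s \<in> SL" "act s w = Const (inverse t ^ D) * w" by (auto simp: orbit_def)
    have "act (mat t ** s) w = act (mat t) (act s w)" by (simp add: act_act)
    also have "\<dots> = Const (t ^ D * inverse t ^ D) * w"
      unfolding s act_mat[OF forms_Const_mult[OF w(1)]] Const_mult by (simp only: mult.assoc)
    also have "\<dots> = w" using \<open>t \<noteq> 0\<close> by (simp flip: power_mult_distrib)
    finally have "mat t ** s \<in> stab w"
      using s \<open>t \<noteq> 0\<close> by (simp add: stab_def GL_iff det_mat_mult SL_def)
    moreover have "det (mat t ** s) = t ^ ?m" using s by (simp add: det_mat_mult SL_def)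
    ultimately show ?thesis by (metis imageI)
  qed
  show dvd: "?m dvd D * g"
  proof (rule ccontr)
    assume "\<not> ?m dvd D * g"
    then obtain u :: complex where "u ^ ?m = 1" "u ^ (D * g) \<noteq> 1"
      using ex_root_unity_power_neq_1[of ?m "D * g"] by auto
    moreover have "mat 1 \<in> stab w" by (simp add: stab_def GL_iff)
    ultimately show False using root[of "mat 1" u] by simp
  qed
  define a where "a = D * g div ?m"
  have a: "D * g = ?m * a" using dvd by (simp add: a_def)
  show "det ` stab w = {x. x ^ (D * g div CARD('m)) = 1}"
    unfolding a_def[symmetric]
  proof (intro equalityI subsetI)
    fix x assume "x \<in> det ` stab w"
    then obtain h where h: "h \<in> stab w" "x = det h" by blast
    obtain t where "t ^ ?m = x" using ex_nth_root[of ?m x] by auto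
    then show "x \<in> {x. x ^ a = 1}" using root[OF h(1), of t] h(2) by (auto simp: a power_mult)
  next
    fix x :: complex assume x: "x \<in> {x. x ^ a = 1}"
    obtain t where t: "t ^ ?m = x" using ex_nth_root[of ?m x] by auto
    then have "t ^ (D * g) = 1" using x by (simp add: a power_mult)
    then show "x \<in> det ` stab w" using root' t by blast
  qed
qed

theorem theorem3p4:
  fixes w :: "'m::finite cpoly" and D :: nat
  assumes "D \<ge> 1"
    and "w \<in> forms D"
    and "w \<noteq> 0"
    and "polystable D w"
  shows "rat_of_int ` group_closure (int ` degree_monoid D w)
       = range (\<lambda>k::int. degree_period D w * of_int k)"
proof -
  let ?g = "Gcd (degree_monoid D w)" and ?m = "CARD('m)"
  define a where "a = D * ?g div ?m"
  have a: "D * ?g = ?m * a" using det_stab(1)[OF assms] by (simp add: a_def)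
  have "D * ?g > 0" using assms scaling_group(1)[OF assms] by simp
  then have "a > 0" unfolding a by simp
  have "stabilizer_period w = a"
    using det_stab(2)[OF assms] card_roots_unity_eq[OF \<open>a > 0\<close>]
    by (simp add: stabilizer_period_def flip: a_def)
  then have "rat_of_nat D * degree_period D w = rat_of_nat (?m * a)"
    using assms(1) by (simp add: degree_period_def)
  also have "\<dots> = rat_of_nat D * rat_of_nat ?g" by (simp flip: a)
  finally have "degree_period D w = rat_of_nat ?g" using assms(1) by simp
  then show ?thesis by (simp add: group_closure_eq image_image)
qed

end
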